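(* Let $X$ be a path-connected space that has a finite covering $X=\bigcup_{i=1}^n U_i$ such that $U_1,\ldots,U_n$ are Borel-measurable sets and the closures $\overline U_1,\ldots,\overline U_n$ are compact and contractible in $X$, and let $x_0\in X$. Then the canonical restriction induces isomorphisms $$H_b^*(X)\to H_{b,x_0}^*(X),\qquad \mathcal H_b^*(X)\to\mathcal H_{b,x_0}^*(X),\qquad \mathcal H^*(X)\to\mathcal H_{x_0}^*(X).$$
   Context: $map(\Delta^k,X)$ is the set of singular $k$-simplices with the compact-open topology and its Borel $\sigma$-algebra. $H_b^*(X)$, $\mathcal H_b^*(X)$ and $\mathcal H^*(X)$ are the cohomology groups of the complexes of, respectively, all bounded functions, all bounded Borel-measurable functions, and all Borel-measurable functions $map(\Delta^k,X)\to\mathbb R$, with the usual simplicial coboundary operator (alternating sum over faces). $S_k^{x_0}(X)\subset map(\Delta^k,X)$ is the subset of simplices mapping all vertices of $\Delta^k$ to $x_0$ (with the subspace topology). $H_{b,x_0}^*(X)$, $\mathcal H_{b,x_0}^*(X)$ and $\mathcal H_{x_0}^*(X)$ are the cohomology groups of the corresponding complexes of bounded, bounded Borel-measurable, respectively Borel-measurable functions $S_k^{x_0}(X)\to\mathbb R$. The canonical restriction restricts functions from $map(\Delta^k,X)$ to $S_k^{x_0}(X)$. A subset $A\subset X$ is contractible in $X$ if its inclusion into $X$ is homotopic (in $X$) to a constant map. *)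

theory Defs
  imports
    "HOL-Analysis.Analysis"
    "HOL-Algebra.Coset"
    "HOL-Homology.Homology"
begin

definition compact_open_topology :: "'a topology \<Rightarrow> 'b topology \<Rightarrow> ('a \<Rightarrow> 'b) topology"
  where "compact_open_topology X Y =
    topology_generated_by
      {{f \<in> extensional (topspace X). continuous_map X Y f \<and> f ` K \<subseteq> U} | K U.
         compactin X K \<and> openin Y U}"

lemma topspace_compact_open_topology [simp]:
  "topspace (compact_open_topology X Y) = {f \<in> extensional (topspace X). continuous_map X Y f}"
proof -
  have "\<exists>K U. compactin X K \<and> openin Y U \<and> f ` K \<subseteq> U" for f
    by (rule exI[of _ "{}"]) auto
  then show ?thesis
    unfolding compact_open_topology_def topology_generated_by_topspace by blast
qed

definition borel_of :: "'a topology \<Rightarrow> 'a measure"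
  where "borel_of T = sigma (topspace T) {U. openin T U}"

definition contractible_subset_in :: "'a topology \<Rightarrow> 'a set \<Rightarrow> bool"
  where "contractible_subset_in X A \<longleftrightarrow>
    A \<subseteq> topspace X \<and>
    (\<exists>c \<in> topspace X. homotopic_with (\<lambda>_. True) (subtopology X A) X (\<lambda>x. x) (\<lambda>_. c))"

type_synonym 'a sing_simplex = "(nat \<Rightarrow> real) \<Rightarrow> 'a"

definition simplices :: "'a topology \<Rightarrow> nat \<Rightarrow> 'a sing_simplex topology"
  where "simplices X k =
    compact_open_topology (subtopology (powertop_real UNIV) (standard_simplex k)) X"

lemma topspace_simplices [simp]: "topspace (simplices X k) = singular_simplex_set k X"
  by (auto simp: simplices_def singular_simplex_def topspace_standard_simplex)

definition based_simplices :: "'a topology \<Rightarrow> 'a \<Rightarrow> nat \<Rightarrow> 'a sing_simplex topology"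
  where "based_simplices X x0 k =
    subtopology (simplices X k) {\<sigma>. \<forall>i\<le>k. simplicial_vertex i \<sigma> = x0}"

text \<open>
  Functions on a space of simplices are represented as extensional functions.
\<close>

definition bounded_functions :: "'s topology \<Rightarrow> ('s \<Rightarrow> real) set"
  where "bounded_functions T = {c \<in> extensional (topspace T). bounded (c ` topspace T)}"

definition measurable_functions :: "'s topology \<Rightarrow> ('s \<Rightarrow> real) set"
  where "measurable_functions T =
    {c \<in> extensional (topspace T). c \<in> borel_measurable (borel_of T)}"

definition bounded_measurable_functions :: "'s topology \<Rightarrow> ('s \<Rightarrow> real) set"
  where "bounded_measurable_functions T = bounded_functions T \<inter> measurable_functions T"

text \<open>
  In the following, \<open>T k\<close> is the space of \<open>k\<close>-simplices under consideration and
  \<open>F\<close> selects the class of real functions serving as cochains. The groups are written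
  multiplicatively in HOL-Algebra, with pointwise addition as the operation.
\<close>

definition cochain_group ::
    "('a sing_simplex topology \<Rightarrow> ('a sing_simplex \<Rightarrow> real) set) \<Rightarrow> (nat \<Rightarrow> 'a sing_simplex topology) \<Rightarrow> nat
      \<Rightarrow> ('a sing_simplex \<Rightarrow> real) monoid"
  where "cochain_group F T k =
    \<lparr>carrier = F (T k),
     monoid.mult = (\<lambda>b c. \<lambda>\<sigma>\<in>topspace (T k). b \<sigma> + c \<sigma>),
     one = (\<lambda>\<sigma>\<in>topspace (T k). 0)\<rparr>"

definition coboundary ::
    "(nat \<Rightarrow> 'a sing_simplex topology) \<Rightarrow> nat \<Rightarrow> ('a sing_simplex \<Rightarrow> real) \<Rightarrow> 'a sing_simplex \<Rightarrow> real"
  where "coboundary T k c =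
    (\<lambda>\<sigma>\<in>topspace (T (Suc k)). \<Sum>i\<le>Suc k. (-1) ^ i * c (singular_face (Suc k) i \<sigma>))"

definition cocycle_group ::
    "('a sing_simplex topology \<Rightarrow> ('a sing_simplex \<Rightarrow> real) set) \<Rightarrow> (nat \<Rightarrow> 'a sing_simplex topology) \<Rightarrow> nat
      \<Rightarrow> ('a sing_simplex \<Rightarrow> real) monoid"
  where "cocycle_group F T k =
    (cochain_group F T k)
      \<lparr>carrier := kernel (cochain_group F T k) (cochain_group F T (Suc k)) (coboundary T k)\<rparr>"

definition coboundaries ::
    "('a sing_simplex topology \<Rightarrow> ('a sing_simplex \<Rightarrow> real) set) \<Rightarrow> (nat \<Rightarrow> 'a sing_simplex topology) \<Rightarrow> nat
      \<Rightarrow> ('a sing_simplex \<Rightarrow> real) set"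
  where "coboundaries F T k =
    (case k of
       0 \<Rightarrow> {\<one>\<^bsub>cochain_group F T 0\<^esub>}
     | Suc j \<Rightarrow> coboundary T j ` carrier (cochain_group F T j))"

definition cohomology_group ::
    "('a sing_simplex topology \<Rightarrow> ('a sing_simplex \<Rightarrow> real) set) \<Rightarrow> (nat \<Rightarrow> 'a sing_simplex topology) \<Rightarrow> nat
      \<Rightarrow> ('a sing_simplex \<Rightarrow> real) set monoid"
  where "cohomology_group F T k = cocycle_group F T k Mod coboundaries F T k"

text \<open>
  The map on cohomology induced by restricting cochains from \<open>T\<close> to a family \<open>T'\<close> of subspaces.
  A class \<open>\<xi>\<close> is a coset of coboundaries; its image is \<open>B' + {c|T' . c \<in> \<xi>}\<close>, where \<open>B'\<close>
  are the coboundaries for \<open>T'\<close>. This is the common class \<open>B' + c|T'\<close> of all \<open>c \<in> \<xi>\<close>.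
\<close>

definition restriction_induced ::
    "('a sing_simplex topology \<Rightarrow> ('a sing_simplex \<Rightarrow> real) set) \<Rightarrow> (nat \<Rightarrow> 'a sing_simplex topology)
      \<Rightarrow> (nat \<Rightarrow> 'a sing_simplex topology) \<Rightarrow> nat
      \<Rightarrow> ('a sing_simplex \<Rightarrow> real) set \<Rightarrow> ('a sing_simplex \<Rightarrow> real) set"
  where "restriction_induced F T T' k \<xi> =
    coboundaries F T' k <#>\<^bsub>cocycle_group F T' k\<^esub> ((\<lambda>c. restrict c (topspace (T' k))) ` \<xi>)"

end

theory Submission
  imports Defs
begin

text \<open>
  Cut the covering down to a finite Borel partition of \<open>X\<close> and let \<open>G v\<close> be the track of \<open>v\<close> under a
  contraction of the piece containing \<open>v\<close>, prolonged to \<open>x0\<close>. A simplex is homotoped, naturally with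
  respect to faces, by dragging each vertex along its track, to a simplex with all vertices at \<open>x0\<close>.
  Fixing the pieces of the vertices of \<open>\<sigma>\<close>, this operation is continuous in \<open>\<sigma>\<close> for the
  compact-open topology (by the tube lemma), hence it is Borel on the space of all simplices.
  By the prism operator, pulling cochains back along it inverts restriction up to chain homotopy. The
  prism operator may be used on the based simplices as well, even though the tracks can move \<open>x0\<close>:
  the vertices of the simplices of the prism lie only at times 0 and 1.
\<close>

subsection \<open>Homological algebra\<close>

text \<open>\<open>G\<close> is continuous only over single pieces, while one simplex may meet many
  pieces, so its points cannot all be moved along \<open>G\<close>. Only the vertices can be, and
  their motion has to be extended over the simplex. An extension chosen by a mere existence argument
  would be neither compatible with faces nor visibly Borel in the simplex. Hence an explicit
  formula: the simplex is shrunk away from its corners, and the tracks of the vertices run over the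
  corners that become free. It reads a simplex only through its values, and it is built from
  barycentric expressions that do not see zero coordinates. All three cohomologies are treated at
  once, since a class of cochains enters only through closure under linear combinations and under
  pullback along Borel maps; the prism operator is a finite alternating sum of such pullbacks.
  Finiteness of the partition gives, in each degree, finitely many patterns of pieces for the
  vertices.\<close>

lemma iso_FactGroup_induced:
  assumes "comm_group Z" and "comm_group Z'" and "subgroup B Z" and "subgroup B' Z'"
    and f: "f \<in> hom Z Z'" and fB: "f ` B \<subseteq> B'"
    and inj: "\<And>c. \<lbrakk>c \<in> carrier Z; f c \<in> B'\<rbrakk> \<Longrightarrow> c \<in> B"
    and surj: "\<And>c'. c' \<in> carrier Z' \<Longrightarrow> \<exists>c\<in>carrier Z. f c \<in> B' #>\<^bsub>Z'\<^esub> c'"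
  shows "(\<lambda>\<xi>. B' <#>\<^bsub>Z'\<^esub> f ` \<xi>) \<in> iso (Z Mod B) (Z' Mod B')"
proof -
  interpret Z: comm_group Z by fact
  interpret Z': comm_group Z' by fact
  interpret f: group_hom Z Z' f by unfold_locales fact
  interpret B: normal B Z by (rule Z.subgroup_imp_normal) fact
  interpret B': normal B' Z' by (rule Z'.subgroup_imp_normal) fact
  let ?\<Phi> = "\<lambda>\<xi>. B' <#>\<^bsub>Z'\<^esub> f ` \<xi>"
  have coset: "?\<Phi> (B #>\<^bsub>Z\<^esub> c) = B' #>\<^bsub>Z'\<^esub> f c" if c: "c \<in> carrier Z" for c
  proof -
    have fc: "f c \<in> carrier Z'" using c by simp
    have "f ` (B #>\<^bsub>Z\<^esub> c) = f ` B #>\<^bsub>Z'\<^esub> f c"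
      using c B.subset by (force simp: r_coset_def)
    moreover have "B' <#>\<^bsub>Z'\<^esub> (f ` B #>\<^bsub>Z'\<^esub> f c) = (B' <#>\<^bsub>Z'\<^esub> f ` B) #>\<^bsub>Z'\<^esub> f c"
      using B'.subset fB fc Z'.setmult_rcos_assoc by blast
    moreover have "B' <#>\<^bsub>Z'\<^esub> f ` B = B'"
    proof
      show "B' <#>\<^bsub>Z'\<^esub> f ` B \<subseteq> B'"
        using fB B'.m_closed by (force simp: set_mult_def)
      have "b = b \<otimes>\<^bsub>Z'\<^esub> f \<one>\<^bsub>Z\<^esub>" if "b \<in> B'" for b
        using that by simp
      then show "B' \<subseteq> B' <#>\<^bsub>Z'\<^esub> f ` B"
        unfolding set_mult_def using B.one_closed by blast
    qed
    ultimately show ?thesis by simp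
  qed
  have "?\<Phi> \<in> hom (Z Mod B) (Z' Mod B')"
  proof (rule homI)
    fix \<xi> assume "\<xi> \<in> carrier (Z Mod B)"
    then obtain c where "c \<in> carrier Z" "\<xi> = B #>\<^bsub>Z\<^esub> c"
      by (auto simp: FactGroup_def RCOSETS_def)
    then show "?\<Phi> \<xi> \<in> carrier (Z' Mod B')"
      using coset by (auto simp: FactGroup_def RCOSETS_def)
  next
    fix \<xi> \<eta> assume "\<xi> \<in> carrier (Z Mod B)" "\<eta> \<in> carrier (Z Mod B)"
    then obtain c d where "c \<in> carrier Z" "\<xi> = B #>\<^bsub>Z\<^esub> c" "d \<in> carrier Z" "\<eta> = B #>\<^bsub>Z\<^esub> d"
      by (auto simp: FactGroup_def RCOSETS_def)
    then show "?\<Phi> (\<xi> \<otimes>\<^bsub>Z Mod B\<^esub> \<eta>) = ?\<Phi> \<xi> \<otimes>\<^bsub>Z' Mod B'\<^esub> ?\<Phi> \<eta>"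
      using coset by (simp add: FactGroup_def B.rcos_sum B'.rcos_sum)
  qed
  moreover have "inj_on ?\<Phi> (carrier (Z Mod B))"
  proof (rule inj_onI)
    fix \<xi> \<eta> assume "\<xi> \<in> carrier (Z Mod B)" "\<eta> \<in> carrier (Z Mod B)" and eq: "?\<Phi> \<xi> = ?\<Phi> \<eta>"
    then obtain c d where cd: "c \<in> carrier Z" "\<xi> = B #>\<^bsub>Z\<^esub> c" "d \<in> carrier Z" "\<eta> = B #>\<^bsub>Z\<^esub> d"
      by (auto simp: FactGroup_def RCOSETS_def)
    then have "f c \<in> B' #>\<^bsub>Z'\<^esub> f d"
      using eq coset Z'.rcos_self[OF f.hom_closed B'.subgroup_axioms] by metis
    then have "f c \<otimes>\<^bsub>Z'\<^esub> inv\<^bsub>Z'\<^esub> f d \<in> B'"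
      using cd by (metis B'.elemrcos_carrier B'.rcos_module_imp Z'.is_group f.hom_closed)
    then have "f (c \<otimes>\<^bsub>Z\<^esub> inv\<^bsub>Z\<^esub> d) \<in> B'"
      using cd by simp
    then have "c \<otimes>\<^bsub>Z\<^esub> inv\<^bsub>Z\<^esub> d \<in> B"
      using cd inj by simp
    then have "c \<in> B #>\<^bsub>Z\<^esub> d"
      using cd by (meson B.rcos_module_rev Z.is_group)
    then show "\<xi> = \<eta>"
      using cd Z.repr_independence B.subgroup_axioms by metis
  qed
  moreover have "carrier (Z' Mod B') \<subseteq> ?\<Phi> ` carrier (Z Mod B)"
  proof
    fix \<xi> assume "\<xi> \<in> carrier (Z' Mod B')"
    then obtain c' where c': "c' \<in> carrier Z'" "\<xi> = B' #>\<^bsub>Z'\<^esub> c'"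
      by (auto simp: FactGroup_def RCOSETS_def)
    with surj obtain c where c: "c \<in> carrier Z" "f c \<in> B' #>\<^bsub>Z'\<^esub> c'" by blast
    then have "\<xi> = ?\<Phi> (B #>\<^bsub>Z\<^esub> c)"
      using c' coset Z'.repr_independence B'.subgroup_axioms by metis
    then show "\<xi> \<in> ?\<Phi> ` carrier (Z Mod B)"
      using c by (auto simp: FactGroup_def RCOSETS_def)
  qed
  ultimately show ?thesis
    unfolding iso_def bij_betw_def hom_def by blast
qed

text \<open>The cancellation behind d d = 0, with \<open>a i j\<close> the value on the
  \<open>j\<close>-th face of the \<open>i\<close>-th face. The pair (i, j) with j < i cancels
  against (j, i - 1): equal values, and exponents that differ by one.\<close>

lemma alternating_double_sum_faces:
  fixes a :: "nat \<Rightarrow> nat \<Rightarrow> real"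
  assumes "\<And>i j. \<lbrakk>j < i; i \<le> Suc n\<rbrakk> \<Longrightarrow> a i j = a j (i - 1)"
  shows "(\<Sum>i\<le>Suc n. (-1) ^ i * (\<Sum>j\<le>n. (-1) ^ j * a i j)) = 0"
proof -
  define s where "s = (\<lambda>(i, j). (-1) ^ (i + j) * a i j)"
  let ?L = "{(i, j). i \<le> Suc n \<and> j < i}" and ?U = "{(i, j). i \<le> j \<and> j \<le> n}"
  have fin: "finite ?L" "finite ?U"
    by (rule finite_subset[of _ "{..Suc n} \<times> {..Suc n}"]; force)+
  have "(\<Sum>i\<le>Suc n. (-1) ^ i * (\<Sum>j\<le>n. (-1) ^ j * a i j)) = sum s ({..Suc n} \<times> {..n})"
    unfolding sum.cartesian_product[symmetric] s_def
    by (simp add: sum_distrib_left power_add mult.assoc del: sum.atMost_Suc)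
  also have "{..Suc n} \<times> {..n} = ?L \<union> ?U" by auto
  also have "sum s (?L \<union> ?U) = sum s ?L + sum s ?U"
    by (rule sum.union_disjoint[OF fin]) auto
  also have "sum s ?L = sum (\<lambda>x. - s x) ?U"
  proof (rule sum.reindex_bij_witness[where j = "\<lambda>(i, j). (j, i - 1)" and i = "\<lambda>(i, j). (Suc j, i)"])
    fix x assume "x \<in> ?L"
    then obtain i j where x: "x = (Suc i, j)" "j \<le> i" "i \<le> n"
      by (cases x; cases "fst x") (auto simp: less_Suc_eq_le)
    with assms[of j "Suc i"] show "- s (case x of (i, j) \<Rightarrow> (j, i - 1)) = s x"
      by (simp add: s_def add.commute)
  qed auto
  also have "\<dots> + sum s ?U = 0" by (simp add: sum_negf)
  finally show ?thesis .
qed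

text \<open>Here \<open>b i j\<close> stands for the value on the \<open>i\<close>-th face of the
  \<open>j\<close>-th simplex of a prism, and \<open>e j i\<close> for the value on the
  \<open>j\<close>-th simplex of the prism over the \<open>i\<close>-th face. Faces away from the
  diagonal match the prisms over faces after an index shift by one, which reverses the sign.\<close>

lemma alternating_double_sum_prism:
  fixes b e :: "nat \<Rightarrow> nat \<Rightarrow> real"
  assumes lo: "\<And>i j. \<lbrakk>i < j; j \<le> n\<rbrakk> \<Longrightarrow> b i j = e (j - 1) i"
    and hi: "\<And>i j. \<lbrakk>Suc j < i; i \<le> Suc n\<rbrakk> \<Longrightarrow> b i j = e j (i - 1)"
    and mid: "\<And>j. j < n \<Longrightarrow> b (Suc j) j = b (Suc j) (Suc j)"
  shows "(\<Sum>j\<le>n. (-1) ^ j * (\<Sum>i\<le>Suc n. (-1) ^ i * b i j))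
    = b 0 0 - b (Suc n) n - (\<Sum>i\<le>n. (-1) ^ i * (\<Sum>j<n. (-1) ^ j * e j i))"
proof -
  define s where "s = (\<lambda>(i, j). (-1) ^ (i + j) * b i j)"
  define u where "u = (\<lambda>(i, j). (-1) ^ (i + j) * e j i)"
  let ?L = "{(i, j). i < j \<and> j \<le> n}" and ?U = "{(i, j). Suc j < i \<and> i \<le> Suc n}"
  let ?D = "(\<lambda>j. (j, j)) ` {..n}" and ?E = "(\<lambda>j. (Suc j, j)) ` {..n}"
  let ?L' = "{(i, j). i \<le> j \<and> j < n}" and ?U' = "{(i, j). j < i \<and> i \<le> n}"
  have fin: "finite ?L" "finite ?U" "finite ?L'" "finite ?U'"
    by (rule finite_subset[of _ "{..Suc n} \<times> {..Suc n}"]; force)+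
  have "(\<Sum>j\<le>n. (-1) ^ j * (\<Sum>i\<le>Suc n. (-1) ^ i * b i j))
    = (\<Sum>j\<le>n. \<Sum>i\<le>Suc n. s (i, j))"
    by (simp add: s_def sum_distrib_left power_add mult_ac del: sum.atMost_Suc)
  also have "\<dots> = sum s ({..Suc n} \<times> {..n})"
    by (subst sum.swap) (simp add: sum.cartesian_product)
  also have "{..Suc n} \<times> {..n} = ?L \<union> ?U \<union> (?D \<union> ?E)" by (auto simp: image_def)
  also have "sum s (?L \<union> ?U \<union> (?D \<union> ?E)) = sum s ?L + sum s ?U + (sum s ?D + sum s ?E)"
  proof -
    have "sum s (?L \<union> ?U) = sum s ?L + sum s ?U" "sum s (?D \<union> ?E) = sum s ?D + sum s ?E"
      by (rule sum.union_disjoint[OF fin(1,2)], force) (rule sum.union_disjoint; force)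
    moreover have "sum s (?L \<union> ?U \<union> (?D \<union> ?E)) = sum s (?L \<union> ?U) + sum s (?D \<union> ?E)"
    proof (rule sum.union_disjoint)
      show "finite (?L \<union> ?U)" using fin by (simp only: finite_Un)
    qed (auto simp: image_iff)
    ultimately show ?thesis by simp
  qed
  \<comment> \<open>The terms with i = j have sign +1, those with i = j + 1 sign -1. By
    \<open>mid\<close> they telescope, which is the gluing of neighbouring simplices of the prism;
    bottom and top remain.\<close>
  also have "sum s ?D + sum s ?E = b 0 0 - b (Suc n) n"
  proof -
    have "sum s ?D = (\<Sum>j\<le>n. b j j)" "sum s ?E = (\<Sum>j\<le>n. - b (Suc j) j)"
      by (simp_all add: sum.reindex inj_on_def s_def del: sum.atMost_Suc)
    moreover have "(\<Sum>j\<le>n. b j j) = b 0 0 + (\<Sum>j<n. b (Suc j) (Suc j))"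
      unfolding lessThan_Suc_atMost[symmetric] by (rule sum.lessThan_Suc_shift)
    moreover have "(\<Sum>j\<le>n. b (Suc j) j) = (\<Sum>j<n. b (Suc j) j) + b (Suc n) n"
      unfolding lessThan_Suc_atMost[symmetric] by (rule sum.lessThan_Suc)
    ultimately show ?thesis using mid by (simp add: sum_negf)
  qed
  also have "sum s ?L = sum (\<lambda>x. - u x) ?L'"
  proof (rule sum.reindex_bij_witness[where j = "\<lambda>(i, j). (i, j - 1)" and i = "\<lambda>(i, j). (i, Suc j)"])
    fix x assume "x \<in> ?L"
    then obtain i j where x: "x = (i, Suc j)" "i \<le> j" "j < n"
      by (cases x; cases "snd x") (auto simp: less_Suc_eq_le less_eq_Suc_le)
    with lo[of i "Suc j"] show "- u (case x of (i, j) \<Rightarrow> (i, j - 1)) = s x"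
      by (simp add: s_def u_def)
  qed auto
  also have "sum s ?U = sum (\<lambda>x. - u x) ?U'"
  proof (rule sum.reindex_bij_witness[where j = "\<lambda>(i, j). (i - 1, j)" and i = "\<lambda>(i, j). (Suc i, j)"])
    fix x assume "x \<in> ?U"
    then obtain i j where x: "x = (Suc i, j)" "j < i" "i \<le> n"
      by (cases x; cases "fst x") auto
    with hi[of j "Suc i"] show "- u (case x of (i, j) \<Rightarrow> (i - 1, j)) = s x"
      by (simp add: s_def u_def)
  qed auto
  also have "sum (\<lambda>x. - u x) ?L' + sum (\<lambda>x. - u x) ?U' = - sum u ({..n} \<times> {..<n})"
  proof -
    have "{..n} \<times> {..<n} = ?L' \<union> ?U'" by auto
    moreover have "sum u (?L' \<union> ?U') = sum u ?L' + sum u ?U'"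
      by (rule sum.union_disjoint[OF fin(3,4)]) auto
    ultimately show ?thesis by (simp add: sum_negf)
  qed
  also have "sum u ({..n} \<times> {..<n}) = (\<Sum>i\<le>n. (-1) ^ i * (\<Sum>j<n. (-1) ^ j * e j i))"
    unfolding sum.cartesian_product[symmetric] u_def
    by (simp add: sum_distrib_left power_add mult.assoc del: sum.atMost_Suc sum.lessThan_Suc)
  finally show ?thesis by simp
qed

section \<open>Borel sigma-algebras and classes of cochains\<close>

lemma space_borel_of [simp]: "space (borel_of T) = topspace T"
  unfolding borel_of_def by (rule space_measure_of) (auto dest: openin_subset)

lemma sets_borel_of: "sets (borel_of T) = sigma_sets (topspace T) {U. openin T U}"
  unfolding borel_of_def by (rule sets_measure_of) (auto dest: openin_subset)

text \<open>\<open>F\<close> is a rule for all spaces of simplices at once, so that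
  \<open>pullback\<close> can relate different spaces. The scaled sum in \<open>add_scaled\<close>
  yields sums, negatives and the alternating sums of the coboundary and the prism operator in one
  axiom.\<close>

locale cochain_class =
  fixes F :: "'a sing_simplex topology \<Rightarrow> ('a sing_simplex \<Rightarrow> real) set"
  assumes extensional: "c \<in> F T \<Longrightarrow> c \<in> extensional (topspace T)"
    and zero: "(\<lambda>\<sigma>\<in>topspace T. 0) \<in> F T"
    and add_scaled: "\<lbrakk>b \<in> F T; c \<in> F T\<rbrakk> \<Longrightarrow> (\<lambda>\<sigma>\<in>topspace T. b \<sigma> + r * c \<sigma>) \<in> F T"
    and pullback: "\<lbrakk>f \<in> borel_of S \<rightarrow>\<^sub>M borel_of T; c \<in> F T\<rbrakk>
      \<Longrightarrow> (\<lambda>\<sigma>\<in>topspace S. c (f \<sigma>)) \<in> F S"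
begin

lemma linear_combination:
  assumes "finite I" and "\<And>i. i \<in> I \<Longrightarrow> (\<lambda>\<sigma>\<in>topspace T. g i \<sigma>) \<in> F T"
  shows "(\<lambda>\<sigma>\<in>topspace T. \<Sum>i\<in>I. r i * g i \<sigma>) \<in> F T"
  using assms
proof (induction I)
  case (insert i I)
  have "(\<lambda>\<sigma>\<in>topspace T. (\<lambda>\<sigma>\<in>topspace T. \<Sum>i\<in>I. r i * g i \<sigma>) \<sigma>
      + r i * (\<lambda>\<sigma>\<in>topspace T. g i \<sigma>) \<sigma>) \<in> F T"
    using insert by (intro add_scaled) auto
  also have "(\<lambda>\<sigma>\<in>topspace T. (\<lambda>\<sigma>\<in>topspace T. \<Sum>i\<in>I. r i * g i \<sigma>) \<sigma>
      + r i * (\<lambda>\<sigma>\<in>topspace T. g i \<sigma>) \<sigma>) = (\<lambda>\<sigma>\<in>topspace T. \<Sum>i\<in>insert i I. r i * g i \<sigma>)"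
    by (rule restrict_ext) (simp add: insert.hyps)
  finally show ?case .
qed (simp add: zero)

lemma comm_group_cochain_group: "comm_group (cochain_group F T k)"
proof (rule comm_groupI)
  fix c assume "c \<in> carrier (cochain_group F T k)"
  then have c: "c \<in> F (T k)" by (simp add: cochain_group_def)
  have "(\<lambda>\<sigma>\<in>topspace (T k). (\<lambda>\<sigma>\<in>topspace (T k). 0) \<sigma> + c \<sigma>) = restrict c (topspace (T k))"
    by (rule restrict_ext) simp
  then show "\<one>\<^bsub>cochain_group F T k\<^esub> \<otimes>\<^bsub>cochain_group F T k\<^esub> c = c"
    using extensional[OF c] by (simp add: cochain_group_def extensional_restrict)
  have "(\<lambda>\<sigma>\<in>topspace (T k). (\<lambda>\<sigma>\<in>topspace (T k). 0) \<sigma> + -1 * c \<sigma>) \<in> F (T k)"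
    using c zero by (intro add_scaled)
  moreover have "(\<lambda>\<sigma>\<in>topspace (T k). (\<lambda>\<sigma>\<in>topspace (T k). 0) \<sigma> + -1 * c \<sigma>)
      \<otimes>\<^bsub>cochain_group F T k\<^esub> c = \<one>\<^bsub>cochain_group F T k\<^esub>"
    by (auto simp: cochain_group_def restrict_def)
  ultimately show "\<exists>b\<in>carrier (cochain_group F T k). b \<otimes>\<^bsub>cochain_group F T k\<^esub> c = \<one>\<^bsub>cochain_group F T k\<^esub>"
    by (intro bexI) (auto simp: cochain_group_def)
next
  fix b c assume "b \<in> carrier (cochain_group F T k)" "c \<in> carrier (cochain_group F T k)"
  then show "b \<otimes>\<^bsub>cochain_group F T k\<^esub> c \<in> carrier (cochain_group F T k)"
    using add_scaled[of b "T k" c 1] by (simp add: cochain_group_def)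
qed (auto simp: cochain_group_def zero add_ac intro!: restrict_ext)

end

section \<open>Face identities and cochain complexes\<close>

lemma simplical_face_simplical_face:
  assumes "j < i"
  shows "simplical_face i (simplical_face j x) = simplical_face j (simplical_face (i - 1) x)"
  using assms by (auto simp: simplical_face_def fun_eq_iff)

lemma singular_face_singular_face:
  assumes "j < i" and "i \<le> Suc (Suc n)"
  shows "singular_face (Suc n) j (singular_face (Suc (Suc n)) i \<sigma>)
    = singular_face (Suc n) (i - 1) (singular_face (Suc (Suc n)) j \<sigma>)"
proof -
  have "simplical_face j x \<in> standard_simplex (Suc n)" "simplical_face (i - 1) x \<in> standard_simplex (Suc n)"
    if "x \<in> standard_simplex n" for x :: "nat \<Rightarrow> real"
    using assms that by (auto intro!: simplical_face_in_standard_simplex)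
  then show ?thesis
    using simplical_face_simplical_face[OF assms(1), where ?'a = real]
    by (simp add: singular_face_def cong: restrict_cong)
qed

text \<open>Measurability includes that the space is mapped into the space, so the single axiom also
  says that faces of members are members.\<close>

locale simplex_family =
  fixes T :: "nat \<Rightarrow> 'a sing_simplex topology"
  assumes face_measurable:
    "i \<le> Suc k \<Longrightarrow> singular_face (Suc k) i \<in> borel_of (T (Suc k)) \<rightarrow>\<^sub>M borel_of (T k)"
begin

lemma face_in_topspace: "\<lbrakk>\<sigma> \<in> topspace (T (Suc k)); i \<le> Suc k\<rbrakk> \<Longrightarrow> singular_face (Suc k) i \<sigma> \<in> topspace (T k)"
  using face_measurable[of i k] by (auto simp: measurable_def)

end

locale cochain_complex = cochain_class F + simplex_family T
  for F :: "'a sing_simplex topology \<Rightarrow> ('a sing_simplex \<Rightarrow> real) set"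
    and T :: "nat \<Rightarrow> 'a sing_simplex topology"
begin

abbreviation "C \<equiv> cochain_group F T"

lemma coboundary_in: "c \<in> F (T k) \<Longrightarrow> coboundary T k c \<in> F (T (Suc k))"
  unfolding coboundary_def
  by (rule linear_combination) (auto intro: pullback face_measurable)

lemma group_hom_coboundary: "group_hom (C k) (C (Suc k)) (coboundary T k)"
proof -
  have "coboundary T k \<in> hom (C k) (C (Suc k))"
  proof (rule homI)
    fix b c
    show "coboundary T k (b \<otimes>\<^bsub>C k\<^esub> c) = coboundary T k b \<otimes>\<^bsub>C (Suc k)\<^esub> coboundary T k c"
      unfolding cochain_group_def coboundary_def
      by (simp, rule restrict_ext)
        (simp add: face_in_topspace distrib_left sum.distrib del: sum.atMost_Suc)
  qed (simp add: cochain_group_def coboundary_in)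
  then show ?thesis
    using comm_group_cochain_group
    by (simp add: group_hom_def group_hom_axioms_def comm_group_def)
qed

lemma coboundary_coboundary: "coboundary T (Suc k) (coboundary T k c) = \<one>\<^bsub>C (Suc (Suc k))\<^esub>"
proof -
  have "(\<Sum>i\<le>Suc (Suc k). (-1) ^ i * coboundary T k c (singular_face (Suc (Suc k)) i \<sigma>)) = 0"
    if \<sigma>: "\<sigma> \<in> topspace (T (Suc (Suc k)))" for \<sigma>
  proof -
    have "(\<Sum>i\<le>Suc (Suc k). (-1) ^ i * coboundary T k c (singular_face (Suc (Suc k)) i \<sigma>))
      = (\<Sum>i\<le>Suc (Suc k). (-1) ^ i * (\<Sum>j\<le>Suc k. (-1) ^ j *
          c (singular_face (Suc k) j (singular_face (Suc (Suc k)) i \<sigma>))))"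
      using face_in_topspace[OF \<sigma>]
      by (intro sum.cong refl) (simp add: coboundary_def del: sum.atMost_Suc)
    also have "\<dots> = 0"
      by (rule alternating_double_sum_faces) (simp only: singular_face_singular_face)
    finally show ?thesis .
  qed
  then show ?thesis
    unfolding cochain_group_def coboundary_def[of T "Suc k"]
    by (simp add: restrict_def fun_eq_iff del: sum.atMost_Suc)
qed

lemma carrier_cocycle_group:
  "carrier (cocycle_group F T k) = {c \<in> F (T k). coboundary T k c = \<one>\<^bsub>C (Suc k)\<^esub>}"
  by (simp add: cocycle_group_def kernel_def cochain_group_def)

lemma cocycle_mult: "b \<otimes>\<^bsub>cocycle_group F T k\<^esub> c = (\<lambda>\<sigma>\<in>topspace (T k). b \<sigma> + c \<sigma>)"
  by (simp add: cocycle_group_def cochain_group_def)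

lemma comm_group_cocycle_group: "comm_group (cocycle_group F T k)"
proof -
  interpret C: comm_group "C k" by (rule comm_group_cochain_group)
  interpret d: group_hom "C k" "C (Suc k)" "coboundary T k" by (rule group_hom_coboundary)
  interpret Z: group "cocycle_group F T k"
    unfolding cocycle_group_def by (rule C.subgroup_imp_group[OF d.subgroup_kernel])
  show ?thesis
    by (rule Z.group_comm_groupI) (simp add: cocycle_mult add.commute)
qed

lemma subgroup_coboundaries: "subgroup (coboundaries F T k) (cocycle_group F T k)"
proof (cases k)
  case 0
  interpret comm_group "cocycle_group F T 0" by (rule comm_group_cocycle_group)
  have "\<one>\<^bsub>cocycle_group F T 0\<^esub> = \<one>\<^bsub>C 0\<^esub>" by (simp add: cocycle_group_def)
  then show ?thesis
    using triv_subgroup 0 by (simp add: coboundaries_def)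
next
  case (Suc j)
  interpret C: comm_group "C (Suc j)" by (rule comm_group_cochain_group)
  interpret d: group_hom "C j" "C (Suc j)" "coboundary T j" by (rule group_hom_coboundary)
  interpret d': group_hom "C (Suc j)" "C (Suc (Suc j))" "coboundary T (Suc j)"
    by (rule group_hom_coboundary)
  have "coboundary T j ` carrier (C j) \<subseteq> kernel (C (Suc j)) (C (Suc (Suc j))) (coboundary T (Suc j))"
    using coboundary_coboundary d.hom_closed by (auto simp: kernel_def)
  then show ?thesis
    unfolding cocycle_group_def Suc coboundaries_def
    using C.subgroup_incl[OF d.img_is_subgroup d'.subgroup_kernel] by simp
qed

text \<open>Translates closure under the multiplicatively written group operations into pointwise
  subtraction; the group inverse has to be recognised as the negative on the simplices of
  \<open>T k\<close>.\<close>

lemma coboundaries_diff: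
  assumes "b \<in> coboundaries F T k" and "c \<in> coboundaries F T k"
  shows "(\<lambda>\<sigma>\<in>topspace (T k). b \<sigma> - c \<sigma>) \<in> coboundaries F T k"
proof -
  interpret comm_group "cocycle_group F T k" by (rule comm_group_cocycle_group)
  interpret subgroup "coboundaries F T k" "cocycle_group F T k" by (rule subgroup_coboundaries)
  let ?d = "(\<lambda>\<sigma>\<in>topspace (T k). b \<sigma> - c \<sigma>)"
  have Z: "b \<in> carrier (cocycle_group F T k)" "c \<in> carrier (cocycle_group F T k)"
    using assms subset by auto
  then have "b \<in> F (T k)" "c \<in> F (T k)" by (auto simp: carrier_cocycle_group)
  have inv: "inv\<^bsub>cocycle_group F T k\<^esub> c \<in> carrier (cocycle_group F T k)" using Z by simp
  have eq: "(\<lambda>\<sigma>\<in>topspace (T k). (inv\<^bsub>cocycle_group F T k\<^esub> c) \<sigma> + c \<sigma>) = (\<lambda>\<sigma>\<in>topspace (T k). 0)"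
    using l_inv[OF Z(2)] unfolding cocycle_mult by (simp add: cocycle_group_def cochain_group_def)
  have "(inv\<^bsub>cocycle_group F T k\<^esub> c) \<sigma> = - c \<sigma>" if "\<sigma> \<in> topspace (T k)" for \<sigma>
    using fun_cong[OF eq, of \<sigma>] that by simp
  then have "?d = b \<otimes>\<^bsub>cocycle_group F T k\<^esub> inv\<^bsub>cocycle_group F T k\<^esub> c"
    unfolding cocycle_mult by (intro restrict_ext) simp
  then show ?thesis using assms by simp
qed

text \<open>The assumptions are the identities of a simplicial homotopy between \<open>P\<close> and
  the identity. The cocycle condition is evaluated on every \<open>h k j \<sigma>\<close> and summed
  over \<open>j\<close> with alternating signs; what survives is the difference of the two ends and
  the coboundary of the prism operator applied to \<open>c\<close>.\<close>

lemma simplicial_homotopy: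
  assumes h: "\<And>k j. j \<le> k \<Longrightarrow> h k j \<in> borel_of (T k) \<rightarrow>\<^sub>M borel_of (T (Suc k))"
    and first: "\<And>k \<sigma>. \<sigma> \<in> topspace (T k) \<Longrightarrow> singular_face (Suc k) 0 (h k 0 \<sigma>) = P k \<sigma>"
    and last: "\<And>k \<sigma>. \<sigma> \<in> topspace (T k) \<Longrightarrow> singular_face (Suc k) (Suc k) (h k k \<sigma>) = \<sigma>"
    and lo: "\<And>k i j \<sigma>. \<lbrakk>i < j; j \<le> k; \<sigma> \<in> topspace (T k)\<rbrakk>
      \<Longrightarrow> singular_face (Suc k) i (h k j \<sigma>) = h (k - 1) (j - 1) (singular_face k i \<sigma>)"
    and hi: "\<And>k i j \<sigma>. \<lbrakk>Suc j < i; i \<le> Suc k; \<sigma> \<in> topspace (T k)\<rbrakk>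
      \<Longrightarrow> singular_face (Suc k) i (h k j \<sigma>) = h (k - 1) j (singular_face k (i - 1) \<sigma>)"
    and mid: "\<And>k j \<sigma>. \<lbrakk>j < k; \<sigma> \<in> topspace (T k)\<rbrakk>
      \<Longrightarrow> singular_face (Suc k) (Suc j) (h k j \<sigma>) = singular_face (Suc k) (Suc j) (h k (Suc j) \<sigma>)"
    and c: "c \<in> carrier (cocycle_group F T k)"
  shows "(\<lambda>\<sigma>\<in>topspace (T k). c (P k \<sigma>) - c \<sigma>) \<in> coboundaries F T k"
proof -
  have eq: "c (P k \<sigma>) - c \<sigma>
      = (\<Sum>i\<le>k. (-1) ^ i * (\<Sum>j<k. (-1) ^ j * c (h (k - 1) j (singular_face k i \<sigma>))))"
    if \<sigma>: "\<sigma> \<in> topspace (T k)" for \<sigma>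
  proof -
    have dc: "coboundary T k c = (\<lambda>\<sigma>\<in>topspace (T (Suc k)). 0)"
      using c by (simp add: carrier_cocycle_group cochain_group_def)
    have "h k j \<sigma> \<in> topspace (T (Suc k))" if "j \<le> k" for j
      using h[OF that] \<sigma> by (auto simp: measurable_def)
    then have "(\<Sum>i\<le>Suc k. (-1) ^ i * c (singular_face (Suc k) i (h k j \<sigma>))) = 0"
      if "j \<le> k" for j
      using that fun_cong[OF dc, of "h k j \<sigma>"]
      by (simp add: coboundary_def del: sum.atMost_Suc)
    then have "0 = (\<Sum>j\<le>k. (-1) ^ j * (\<Sum>i\<le>Suc k. (-1) ^ i * c (singular_face (Suc k) i (h k j \<sigma>))))"
      by (simp del: sum.atMost_Suc)
    also have "\<dots> = c (singular_face (Suc k) 0 (h k 0 \<sigma>)) - c (singular_face (Suc k) (Suc k) (h k k \<sigma>))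
       - (\<Sum>i\<le>k. (-1) ^ i * (\<Sum>j<k. (-1) ^ j * c (h (k - 1) j (singular_face k i \<sigma>))))"
      by (rule alternating_double_sum_prism) (simp_all add: lo hi mid \<sigma>)
    finally show ?thesis by (simp add: first last \<sigma>)
  qed
  show ?thesis
  proof (cases k)
    \<comment> \<open>The sum over \<open>j < k\<close> is empty, so the difference is zero, the
      only coboundary in degree 0.\<close>
    case 0
    then show ?thesis
      using eq by (simp add: coboundaries_def cochain_group_def cong: restrict_cong)
  next
    case (Suc m)
    \<comment> \<open>The prism operator applied to \<open>c\<close>, a primitive one degree
      lower.\<close>
    define D where "D = (\<lambda>\<sigma>\<in>topspace (T m). \<Sum>j\<le>m. (-1) ^ j * c (h m j \<sigma>))"
    have "c \<in> F (T (Suc m))" using c Suc by (simp add: carrier_cocycle_group)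
    then have "D \<in> carrier (C m)"
      unfolding D_def cochain_group_def by (auto intro!: linear_combination intro: pullback h)
    moreover have "(\<lambda>\<sigma>\<in>topspace (T k). c (P k \<sigma>) - c \<sigma>) = coboundary T m D"
      unfolding coboundary_def Suc[symmetric]
    proof (rule restrict_ext)
      fix \<sigma> assume \<sigma>: "\<sigma> \<in> topspace (T k)"
      then have "singular_face k i \<sigma> \<in> topspace (T m)" if "i \<le> k" for i
        using that Suc face_in_topspace by simp
      moreover have "{..<k} = {..m}" "k - 1 = m" using Suc by auto
      ultimately show "c (P k \<sigma>) - c \<sigma> = (\<Sum>i\<le>k. (-1) ^ i * D (singular_face k i \<sigma>))"
        using eq[OF \<sigma>] by (simp add: D_def)
    qed
    ultimately show ?thesis
      by (simp add: Suc coboundaries_def)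
  qed
qed

end

section \<open>Pullback of cochains and the criterion for an isomorphism\<close>

text \<open>Serves in both directions: with the inclusion of the smaller family, where the pullback
  is restriction, and with the map \<open>P\<close> back into it.\<close>

locale cochain_pullback = cochain_class F + S: simplex_family S + T: simplex_family T
  for F :: "'a sing_simplex topology \<Rightarrow> ('a sing_simplex \<Rightarrow> real) set"
    and S T :: "nat \<Rightarrow> 'a sing_simplex topology" +
  fixes g :: "nat \<Rightarrow> 'a sing_simplex \<Rightarrow> 'a sing_simplex"
  assumes g_measurable: "g k \<in> borel_of (S k) \<rightarrow>\<^sub>M borel_of (T k)"
    and g_face: "\<lbrakk>\<sigma> \<in> topspace (S (Suc k)); i \<le> Suc k\<rbrakk>
      \<Longrightarrow> singular_face (Suc k) i (g (Suc k) \<sigma>) = g k (singular_face (Suc k) i \<sigma>)"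
begin

sublocale S: cochain_complex F S ..
sublocale T: cochain_complex F T ..

lemma g_in: "\<sigma> \<in> topspace (S k) \<Longrightarrow> g k \<sigma> \<in> topspace (T k)"
  using g_measurable[of k] by (auto simp: measurable_def)

lemma pull_in: "c \<in> F (T k) \<Longrightarrow> (\<lambda>\<sigma>\<in>topspace (S k). c (g k \<sigma>)) \<in> F (S k)"
  using g_measurable by (rule pullback)

lemma coboundary_pull:
  "coboundary S k (\<lambda>\<sigma>\<in>topspace (S k). c (g k \<sigma>))
    = (\<lambda>\<sigma>\<in>topspace (S (Suc k)). coboundary T k c (g (Suc k) \<sigma>))"
  unfolding coboundary_def
  by (rule restrict_ext) (auto simp: g_in g_face S.face_in_topspace simp del: sum.atMost_Suc)

lemma pull_cocycle:
  assumes "c \<in> carrier (cocycle_group F T k)"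
  shows "(\<lambda>\<sigma>\<in>topspace (S k). c (g k \<sigma>)) \<in> carrier (cocycle_group F S k)"
  using assms unfolding S.carrier_cocycle_group T.carrier_cocycle_group
  by (auto simp: pull_in coboundary_pull cochain_group_def g_in cong: restrict_cong)

lemma pull_coboundary:
  assumes "c \<in> coboundaries F T k"
  shows "(\<lambda>\<sigma>\<in>topspace (S k). c (g k \<sigma>)) \<in> coboundaries F S k"
proof (cases k)
  case 0
  with assms show ?thesis
    by (auto simp: coboundaries_def cochain_group_def g_in restrict_def)
next
  case (Suc m)
  with assms obtain b where b: "b \<in> F (T m)" "c = coboundary T m b"
    by (auto simp: coboundaries_def cochain_group_def)
  then have "(\<lambda>\<sigma>\<in>topspace (S k). c (g k \<sigma>)) = coboundary S m (\<lambda>\<sigma>\<in>topspace (S m). b (g m \<sigma>))"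
    by (simp add: coboundary_pull Suc)
  with b Suc show ?thesis
    using pull_in by (auto simp: coboundaries_def cochain_group_def)
qed

end

text \<open>The same \<open>h\<close> joins \<open>P\<close> to the identity on both families. On
  \<open>T\<close> it shows that a cocycle is determined up to coboundaries by its restriction; on
  \<open>T'\<close> it shows that pulling back along \<open>P\<close> and then restricting returns
  the class one started from.\<close>

theorem (in cochain_class) restriction_induced_iso:
  assumes T: "simplex_family T" and T': "simplex_family T'"
    and sub: "\<And>k. id \<in> borel_of (T' k) \<rightarrow>\<^sub>M borel_of (T k)"
    and P: "\<And>k. P k \<in> borel_of (T k) \<rightarrow>\<^sub>M borel_of (T' k)"
    and P_face: "\<And>k i \<sigma>. \<lbrakk>\<sigma> \<in> topspace (T (Suc k)); i \<le> Suc k\<rbrakk>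
      \<Longrightarrow> singular_face (Suc k) i (P (Suc k) \<sigma>) = P k (singular_face (Suc k) i \<sigma>)"
    and h: "\<And>k j. j \<le> k \<Longrightarrow> h k j \<in> borel_of (T k) \<rightarrow>\<^sub>M borel_of (T (Suc k))"
    and h': "\<And>k j. j \<le> k \<Longrightarrow> h k j \<in> borel_of (T' k) \<rightarrow>\<^sub>M borel_of (T' (Suc k))"
    and first: "\<And>k \<sigma>. \<sigma> \<in> topspace (T k) \<Longrightarrow> singular_face (Suc k) 0 (h k 0 \<sigma>) = P k \<sigma>"
    and last: "\<And>k \<sigma>. \<sigma> \<in> topspace (T k) \<Longrightarrow> singular_face (Suc k) (Suc k) (h k k \<sigma>) = \<sigma>"
    and lo: "\<And>k i j \<sigma>. \<lbrakk>i < j; j \<le> k; \<sigma> \<in> topspace (T k)\<rbrakk>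
      \<Longrightarrow> singular_face (Suc k) i (h k j \<sigma>) = h (k - 1) (j - 1) (singular_face k i \<sigma>)"
    and hi: "\<And>k i j \<sigma>. \<lbrakk>Suc j < i; i \<le> Suc k; \<sigma> \<in> topspace (T k)\<rbrakk>
      \<Longrightarrow> singular_face (Suc k) i (h k j \<sigma>) = h (k - 1) j (singular_face k (i - 1) \<sigma>)"
    and mid: "\<And>k j \<sigma>. \<lbrakk>j < k; \<sigma> \<in> topspace (T k)\<rbrakk>
      \<Longrightarrow> singular_face (Suc k) (Suc j) (h k j \<sigma>) = singular_face (Suc k) (Suc j) (h k (Suc j) \<sigma>)"
  shows "restriction_induced F T T' k \<in> iso (cohomology_group F T k) (cohomology_group F T' k)"
proof -
  interpret T: simplex_family T by fact
  interpret T': simplex_family T' by fact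
  interpret T: cochain_complex F T ..
  interpret T': cochain_complex F T' ..
  interpret R: cochain_pullback F T' T "\<lambda>_. id" by unfold_locales (use sub in auto)
  interpret P: cochain_pullback F T T' P by unfold_locales (use P P_face in auto)
  have T'T: "\<sigma> \<in> topspace (T k)" if "\<sigma> \<in> topspace (T' k)" for \<sigma> k
    using R.g_in[OF that] by simp
  have res: "restrict c (topspace (T' k)) = (\<lambda>\<sigma>\<in>topspace (T' k). c (id \<sigma>))" for c
    by simp
  have "(\<lambda>\<xi>. coboundaries F T' k <#>\<^bsub>cocycle_group F T' k\<^esub> (\<lambda>c. restrict c (topspace (T' k))) ` \<xi>)
    \<in> iso (cocycle_group F T k Mod coboundaries F T k) (cocycle_group F T' k Mod coboundaries F T' k)"
  proof (rule iso_FactGroup_induced)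
    show "(\<lambda>c. restrict c (topspace (T' k))) \<in> hom (cocycle_group F T k) (cocycle_group F T' k)"
      using R.pull_cocycle T'T by (auto intro!: homI simp: T.cocycle_mult T'.cocycle_mult restrict_def)
    show "(\<lambda>c. restrict c (topspace (T' k))) ` coboundaries F T k \<subseteq> coboundaries F T' k"
      using R.pull_coboundary by auto
  next
    fix c assume c: "c \<in> carrier (cocycle_group F T k)" and "restrict c (topspace (T' k)) \<in> coboundaries F T' k"
    from P.pull_coboundary[OF this(2)]
    have "(\<lambda>\<sigma>\<in>topspace (T k). c (P k \<sigma>)) \<in> coboundaries F T k"
      by (simp add: P.g_in cong: restrict_cong)
    moreover have "(\<lambda>\<sigma>\<in>topspace (T k). c (P k \<sigma>) - c \<sigma>) \<in> coboundaries F T k"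
      by (rule T.simplicial_homotopy[of h]) (use h first last lo hi mid c in auto)
    \<comment> \<open>The pointwise difference of the two coboundaries is \<open>c\<close>
      itself.\<close>
    ultimately have "(\<lambda>\<sigma>\<in>topspace (T k). (\<lambda>\<sigma>\<in>topspace (T k). c (P k \<sigma>)) \<sigma>
        - (\<lambda>\<sigma>\<in>topspace (T k). c (P k \<sigma>) - c \<sigma>) \<sigma>) \<in> coboundaries F T k"
      by (rule T.coboundaries_diff)
    moreover have "c \<in> extensional (topspace (T k))"
      using c extensional by (simp add: T.carrier_cocycle_group)
    ultimately show "c \<in> coboundaries F T k"
      by (simp add: extensional_restrict cong: restrict_cong)
  next
    fix c assume c: "c \<in> carrier (cocycle_group F T' k)"
    define p where "p = (\<lambda>\<sigma>\<in>topspace (T k). c (P k \<sigma>))"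
    define d where "d = (\<lambda>\<sigma>\<in>topspace (T' k). c (P k \<sigma>) - c \<sigma>)"
    have "p \<in> carrier (cocycle_group F T k)"
      unfolding p_def using c by (rule P.pull_cocycle)
    moreover have "d \<in> coboundaries F T' k"
      unfolding d_def by (rule T'.simplicial_homotopy[of h]) (use h' first last lo hi mid c T'T in auto)
    moreover have "restrict p (topspace (T' k)) = d \<otimes>\<^bsub>cocycle_group F T' k\<^esub> c"
      unfolding T'.cocycle_mult by (auto simp: p_def d_def restrict_def T'T)
    ultimately show "\<exists>p\<in>carrier (cocycle_group F T k).
        restrict p (topspace (T' k)) \<in> coboundaries F T' k #>\<^bsub>cocycle_group F T' k\<^esub> c"
      unfolding r_coset_def by blast
  qed (simp_all add: T.comm_group_cocycle_group T'.comm_group_cocycle_group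
      T.subgroup_coboundaries T'.subgroup_coboundaries)
  then show ?thesis
    unfolding cohomology_group_def restriction_induced_def[abs_def] .
qed

section \<open>The three classes of cochains\<close>

lemma cochain_class_bounded: "cochain_class bounded_functions"
proof
  fix b c :: "'a sing_simplex \<Rightarrow> real" and T and r
  assume "b \<in> bounded_functions T" "c \<in> bounded_functions T"
  then show "(\<lambda>\<sigma>\<in>topspace T. b \<sigma> + r * c \<sigma>) \<in> bounded_functions T"
    using bounded_plus_comp[of b "topspace T" "\<lambda>\<sigma>. r * c \<sigma>"] bounded_scaleR_comp[of c "topspace T" r]
    by (simp add: bounded_functions_def)
next
  fix f :: "'a sing_simplex \<Rightarrow> 'a sing_simplex" and S T and c
  assume f: "f \<in> borel_of S \<rightarrow>\<^sub>M borel_of T" and c: "c \<in> bounded_functions T"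
  have "(\<lambda>\<sigma>. c (f \<sigma>)) ` topspace S \<subseteq> c ` topspace T"
    using f by (auto simp: measurable_def)
  with c show "(\<lambda>\<sigma>\<in>topspace S. c (f \<sigma>)) \<in> bounded_functions S"
    using bounded_subset by (auto simp: bounded_functions_def)
qed (auto simp: bounded_functions_def image_def)

text \<open>Measurability sees only values on the space, so passing to the extensional
  representative preserves it.\<close>

lemma restrict_measurable_functions:
  assumes "c \<in> borel_measurable (borel_of T)"
  shows "restrict c (topspace T) \<in> measurable_functions T"
proof -
  have "restrict c (topspace T) \<in> borel_measurable (borel_of T) \<longleftrightarrow> c \<in> borel_measurable (borel_of T)"
    by (rule measurable_cong) simp
  then show ?thesis using assms by (simp add: measurable_functions_def)
qed

lemma cochain_class_measurable: "cochain_class measurable_functions"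
proof
  fix b c :: "'a sing_simplex \<Rightarrow> real" and T and r
  assume "b \<in> measurable_functions T" "c \<in> measurable_functions T"
  then have "(\<lambda>\<sigma>. b \<sigma> + r * c \<sigma>) \<in> borel_measurable (borel_of T)"
    by (auto simp: measurable_functions_def)
  then show "(\<lambda>\<sigma>\<in>topspace T. b \<sigma> + r * c \<sigma>) \<in> measurable_functions T"
    by (rule restrict_measurable_functions)
next
  fix f :: "'a sing_simplex \<Rightarrow> 'a sing_simplex" and S T and c
  assume "f \<in> borel_of S \<rightarrow>\<^sub>M borel_of T" "c \<in> measurable_functions T"
  then show "(\<lambda>\<sigma>\<in>topspace S. c (f \<sigma>)) \<in> measurable_functions S"
    by (intro restrict_measurable_functions) (auto simp: measurable_functions_def)
next
  show "(\<lambda>\<sigma>\<in>topspace T. 0) \<in> measurable_functions T" for T :: "'a sing_simplex topology"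
    by (rule restrict_measurable_functions) simp
qed (simp add: measurable_functions_def)

lemma cochain_class_bounded_measurable: "cochain_class bounded_measurable_functions"
proof -
  interpret b: cochain_class bounded_functions by (rule cochain_class_bounded)
  interpret m: cochain_class measurable_functions by (rule cochain_class_measurable)
  show ?thesis
    by unfold_locales
      (auto simp: bounded_measurable_functions_def b.extensional b.zero m.zero
        intro: b.add_scaled m.add_scaled b.pullback m.pullback)
qed

subsection \<open>Collapsing the corners of a simplex\<close>

abbreviation unit_vertex :: "nat \<Rightarrow> nat \<Rightarrow> real"
  where "unit_vertex i \<equiv> \<lambda>j. if j = i then 1 else 0"

text \<open>In the distance d = 1 - a from the vertex this is a tent: d up to d = t/6, then t/3 - d
  down to 0 at d = t/3. The rising part equals the total of all other coordinates, so subtracting it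
  clears each of them; the falling part makes the cutoff die out continuously.\<close>

definition vertex_weight :: "real \<Rightarrow> real \<Rightarrow> real"
  where "vertex_weight t a = max 0 (min (1 - a) (t / 3 - (1 - a)))"

text \<open>
  At time \<open>t\<close> the map \<open>squeeze k t\<close> collapses the corner \<open>1 - x j \<le> t / 6\<close> of the simplex to its
  vertex \<open>j\<close>, by subtracting a cutoff from all barycentric coordinates and renormalising; the
  corner thus freed is used for the track of the vertex, which \<open>travel k t\<close> parametrises.
  At most one \<open>vertex_weight t (x j)\<close> is nonzero, as it forces \<open>x j > 2/3\<close>. All formulas are
  symmetric sums of terms vanishing on zero coordinates, so they are compatible with face maps.
\<close>

definition cutoff :: "nat \<Rightarrow> real \<Rightarrow> (nat \<Rightarrow> real) \<Rightarrow> real"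
  where "cutoff k t x = (\<Sum>j\<le>k. vertex_weight t (x j))"

definition squeeze :: "nat \<Rightarrow> real \<Rightarrow> (nat \<Rightarrow> real) \<Rightarrow> nat \<Rightarrow> real"
  where "squeeze k t x =
    (\<lambda>i. max 0 (x i - cutoff k t x) / (\<Sum>j\<le>k. max 0 (x j - cutoff k t x)))"

definition travel :: "nat \<Rightarrow> real \<Rightarrow> (nat \<Rightarrow> real) \<Rightarrow> real"
  where "travel k t x = (\<Sum>j\<le>k. max 0 (t - 6 * (1 - x j)))"

lemma standard_simplexD:
  assumes "x \<in> standard_simplex k"
  shows "0 \<le> x i" "x i \<le> 1" "i > k \<Longrightarrow> x i = 0" "(\<Sum>i\<le>k. x i) = 1"
  using assms by (auto simp: standard_simplex_def)

lemma standard_simplexI: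
  assumes "\<And>i. 0 \<le> x i" and "\<And>i. i > k \<Longrightarrow> x i = 0" and "(\<Sum>i\<le>k. x i) = 1"
  shows "x \<in> standard_simplex k"
proof -
  have "x i \<le> 1" for i
  proof (cases "i \<le> k")
    case True
    then have "x i \<le> (\<Sum>i\<le>k. x i)" using assms(1) by (intro member_le_sum) auto
    then show ?thesis using assms(3) by simp
  qed (use assms(2) in simp)
  then show ?thesis using assms by (auto simp: standard_simplex_def)
qed

lemma standard_simplex_add_le_1:
  assumes x: "x \<in> standard_simplex k" and "i \<noteq> j"
  shows "x i + x j \<le> 1"
proof (cases "i \<le> k \<and> j \<le> k")
  case True
  then have "x i + x j = sum x {i, j}" using assms by simp
  also have "\<dots> \<le> sum x {..k}"
    using True by (intro sum_mono2) (auto simp: standard_simplexD[OF x])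
  finally show ?thesis by (simp add: standard_simplexD[OF x])
next
  case False
  then consider "i > k" | "j > k" by linarith
  then show ?thesis
    by cases (simp_all add: standard_simplexD[OF x])
qed

text \<open>A face map inserts one zero coordinate, whence \<open>f 0\<close>. For \<open>f\<close>
  vanishing at 0 the two sums agree, and this is the source of naturality for \<open>cutoff\<close>,
  \<open>squeeze\<close> and \<open>travel\<close>.\<close>

lemma sum_simplical_face:
  assumes "l \<le> Suc k"
  shows "(\<Sum>j\<le>Suc k. f (simplical_face l x j)) = f 0 + (\<Sum>j\<le>k. f (x j))"
proof -
  have "(\<Sum>j\<le>Suc k. f (simplical_face l x j)) = f (simplical_face l x l)
      + (\<Sum>j\<in>{..Suc k} - {l}. f (simplical_face l x j))"
    by (rule sum.remove) (use assms in auto)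
  also have "(\<Sum>j\<in>{..Suc k} - {l}. f (simplical_face l x j)) = (\<Sum>j\<le>k. f (x j))"
    by (rule sum.reindex_bij_witness[where j = "\<lambda>j. if j < l then j else j - 1"
          and i = "\<lambda>j. if j < l then j else Suc j"])
      (use assms in \<open>auto simp: simplical_face_def\<close>)
  finally show ?thesis by (simp add: simplical_face_def)
qed

context
  fixes k :: nat and t :: real and x :: "nat \<Rightarrow> real"
  assumes x: "x \<in> standard_simplex k" and t: "0 \<le> t" "t \<le> 1"
begin

lemma cutoff_nonneg: "0 \<le> cutoff k t x"
  unfolding cutoff_def by (intro sum_nonneg) (simp add: vertex_weight_def)

lemma cutoff_eq_vertex_weight:
  assumes "j \<le> k" and "2/3 < x j"
  shows "cutoff k t x = vertex_weight t (x j)"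
proof -
  have "vertex_weight t (x i) = 0" if "i \<noteq> j" for i
    using standard_simplex_add_le_1[OF x that] assms t by (auto simp: vertex_weight_def)
  then have "(\<Sum>i\<in>{..k} - {j}. vertex_weight t (x i)) = 0" by simp
  then show ?thesis
    unfolding cutoff_def using assms(1) by (subst sum.remove[of _ j]) auto
qed

text \<open>The normalisation never divides by zero. If some \<open>x j\<close> exceeds 2/3, the
  cutoff is at most \<open>1 - x j\<close>, hence less than \<open>x j\<close>; otherwise it is zero
  and the coordinates still sum to 1.\<close>

lemma mass_pos: "0 < (\<Sum>j\<le>k. max 0 (x j - cutoff k t x))"
proof (cases "\<exists>j\<le>k. 2/3 < x j")
  case True
  then obtain j where j: "j \<le> k" "2/3 < x j" by blast
  have "cutoff k t x < x j"
    unfolding cutoff_eq_vertex_weight[OF j] using j standard_simplexD(2)[OF x, of j]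
    by (auto simp: vertex_weight_def)
  then have "0 < max 0 (x j - cutoff k t x)" by simp
  also have "\<dots> \<le> (\<Sum>j\<le>k. max 0 (x j - cutoff k t x))"
    by (rule member_le_sum[where f = "\<lambda>j. max 0 (x j - cutoff k t x)"]) (use j in auto)
  finally show ?thesis .
next
  case False
  have "vertex_weight t (x j) = 0" if "j \<le> k" for j
  proof -
    have "x j \<le> 2/3" using False that by (simp add: not_less)
    then show ?thesis using t by (simp add: vertex_weight_def max_def min_def)
  qed
  then have "cutoff k t x = 0" by (simp add: cutoff_def)
  then show ?thesis using standard_simplexD[OF x] by (simp add: max_def)
qed

lemma squeeze_in: "squeeze k t x \<in> standard_simplex k"
proof (rule standard_simplexI)
  show "0 \<le> squeeze k t x i" for i
    unfolding squeeze_def using mass_pos by simp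
  show "squeeze k t x i = 0" if "i > k" for i
    unfolding squeeze_def using standard_simplexD(3)[OF x that] cutoff_nonneg by simp
  show "(\<Sum>i\<le>k. squeeze k t x i) = 1"
    unfolding squeeze_def sum_divide_distrib[symmetric] using mass_pos by simp
qed

lemma squeeze_near_vertex:
  assumes "j \<le> k" and near: "1 - x j \<le> t / 6"
  shows "squeeze k t x = unit_vertex j"
proof -
  \<comment> \<open>The assumption \<open>near\<close> places the point on the rising side of the
    tent, where the weight is \<open>1 - x j\<close>, a bound for every other coordinate.\<close>
  have "1 - x j \<le> cutoff k t x"
    using cutoff_eq_vertex_weight[of j] assms t by (auto simp: vertex_weight_def)
  then have z: "max 0 (x i - cutoff k t x) = 0" if "i \<noteq> j" for i
    using standard_simplex_add_le_1[OF x that] by simp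
  then have "(\<Sum>i\<in>{..k} - {j}. max 0 (x i - cutoff k t x)) = 0" by simp
  then have mass: "(\<Sum>i\<le>k. max 0 (x i - cutoff k t x)) = max 0 (x j - cutoff k t x)"
    using assms(1) by (subst sum.remove[of _ j]) auto
  show ?thesis
    unfolding squeeze_def mass using z mass_pos unfolding mass by (auto simp: fun_eq_iff)
qed

text \<open>The factor 6 makes time fall linearly from \<open>t\<close> at the vertex to 0 at the
  rim \<open>1 - x j = t / 6\<close> of the collapsed corner. The other summands vanish there
  because their coordinates are at most 1/6.\<close>

lemma travel_near_vertex:
  assumes "j \<le> k" and near: "1 - x j \<le> t / 6"
  shows "travel k t x = t - 6 * (1 - x j)"
proof -
  have "max 0 (t - 6 * (1 - x i)) = 0" if "i \<noteq> j" for i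
    using standard_simplex_add_le_1[OF x that] assms t by simp
  then have "(\<Sum>i\<in>{..k} - {j}. max 0 (t - 6 * (1 - x i))) = 0" by simp
  then show ?thesis
    unfolding travel_def using assms by (subst sum.remove[of _ j]) auto
qed

lemma travel_away_from_vertices:
  assumes "\<And>j. j \<le> k \<Longrightarrow> t / 6 \<le> 1 - x j"
  shows "travel k t x = 0"
  unfolding travel_def using assms by (intro sum.neutral) force

lemma squeeze_face:
  assumes "l \<le> Suc k"
  shows "squeeze (Suc k) t (simplical_face l x) = simplical_face l (squeeze k t x)"
proof -
  have "cutoff (Suc k) t (simplical_face l x) = cutoff k t x"
    unfolding cutoff_def sum_simplical_face[OF assms] using t by (simp add: vertex_weight_def)
  then show ?thesis
    using cutoff_nonneg unfolding squeeze_def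
    by (simp only: sum_simplical_face[OF assms, where f = "\<lambda>a. max 0 (a - cutoff k t x)"])
      (auto simp: simplical_face_def fun_eq_iff)
qed

lemma travel_face:
  assumes "l \<le> Suc k"
  shows "travel (Suc k) t (simplical_face l x) = travel k t x"
  unfolding travel_def using t
  by (simp only: sum_simplical_face[OF assms, where f = "\<lambda>a. max 0 (t - 6 * (1 - a))"]) simp

end

lemma squeeze_0:
  assumes "x \<in> standard_simplex k"
  shows "squeeze k 0 x = x"
proof -
  have "cutoff k 0 x = 0"
    unfolding cutoff_def by (intro sum.neutral) (auto simp: vertex_weight_def)
  then show ?thesis
    using standard_simplexD[OF assms] by (simp add: squeeze_def max_def)
qed

lemma travel_0:
  assumes "x \<in> standard_simplex k"
  shows "travel k 0 x = 0"
  using travel_away_from_vertices[OF assms, of 0] standard_simplexD[OF assms] by simp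

lemma squeeze_vertex:
  assumes "l \<le> k" "0 \<le> t" "t \<le> 1"
  shows "squeeze k t (unit_vertex l) = unit_vertex l"
  by (rule squeeze_near_vertex) (use assms in auto)

lemma travel_vertex:
  assumes "l \<le> k" "0 \<le> t" "t \<le> 1"
  shows "travel k t (unit_vertex l) = t"
  using travel_near_vertex[of "unit_vertex l" k t l] assms by simp

lemma travel_bounds:
  assumes x: "x \<in> standard_simplex k" and t: "0 \<le> t" "t \<le> 1"
  shows "0 \<le> travel k t x" "travel k t x \<le> 1"
proof -
  show "0 \<le> travel k t x" unfolding travel_def by (intro sum_nonneg) simp
  show "travel k t x \<le> 1"
  proof (cases "\<exists>j\<le>k. 1 - x j \<le> t / 6")
    case True
    then obtain j where "j \<le> k" "1 - x j \<le> t / 6" by blast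
    then show ?thesis
      using travel_near_vertex[OF x t] standard_simplexD(2)[OF x, of j] t by simp
  next
    case False
    then have "travel k t x = 0"
      by (intro travel_away_from_vertices[OF x t]) force
    then show ?thesis by simp
  qed
qed

section \<open>Joint continuity in point and time\<close>

abbreviation simplex_top :: "nat \<Rightarrow> (nat \<Rightarrow> real) topology"
  where "simplex_top k \<equiv> subtopology (powertop_real UNIV) (standard_simplex k)"

lemma continuous_map_component:
  "continuous_map Y (powertop_real UNIV) a \<Longrightarrow> continuous_map Y euclideanreal (\<lambda>y. a y i)"
  by (simp add: continuous_map_componentwise_UNIV)

lemma continuous_map_cutoff:
  assumes "continuous_map Y (powertop_real UNIV) a" and "continuous_map Y euclideanreal b"
  shows "continuous_map Y euclideanreal (\<lambda>y. cutoff k (b y) (a y))"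
  unfolding cutoff_def vertex_weight_def
  by (intro continuous_intros continuous_map_component[OF assms(1)] assms(2)) auto

lemma continuous_map_squeeze:
  assumes a: "continuous_map Y (simplex_top k) a" and b: "continuous_map Y euclideanreal b"
    and b01: "\<And>y. y \<in> topspace Y \<Longrightarrow> b y \<in> {0..1}"
  shows "continuous_map Y (simplex_top k) (\<lambda>y. squeeze k (b y) (a y))"
proof -
  have a': "continuous_map Y (powertop_real UNIV) a" "\<And>y. y \<in> topspace Y \<Longrightarrow> a y \<in> standard_simplex k"
    using a by (auto simp: continuous_map_in_subtopology)
  have "continuous_map Y (powertop_real UNIV) (\<lambda>y. squeeze k (b y) (a y))"
    unfolding continuous_map_componentwise_UNIV
  proof
    fix i
    have "(\<Sum>j\<le>k. max 0 (a y j - cutoff k (b y) (a y))) \<noteq> 0" if "y \<in> topspace Y" for y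
      using mass_pos[of "a y" k "b y"] a'(2)[OF that] b01[OF that] by simp
    then show "continuous_map Y euclideanreal (\<lambda>y. squeeze k (b y) (a y) i)"
      unfolding squeeze_def
      by (intro continuous_intros continuous_map_component[OF a'(1)] continuous_map_cutoff[OF a'(1) b]) auto
  qed
  then show ?thesis
    using squeeze_in a'(2) b01 by (auto simp: continuous_map_in_subtopology)
qed

lemma continuous_map_travel:
  assumes "continuous_map Y (powertop_real UNIV) a" and "continuous_map Y euclideanreal b"
  shows "continuous_map Y euclideanreal (\<lambda>y. travel k (b y) (a y))"
  unfolding travel_def
  by (intro continuous_intros continuous_map_component[OF assms(1)] assms(2)) auto

text \<open>
  \<open>(degeneracy j, prism_height j)\<close> is the affine map of the simplex onto the \<open>j\<close>-th simplex of the
  standard triangulation of the prism, with vertices \<open>0, \<dots>, j\<close> at height 0 and \<open>j, \<dots>, k\<close> at height 1.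
\<close>

definition degeneracy :: "nat \<Rightarrow> (nat \<Rightarrow> real) \<Rightarrow> nat \<Rightarrow> real"
  where "degeneracy j y = (\<lambda>i. if i < j then y i else if i = j then y j + y (Suc j) else y (Suc i))"

definition prism_height :: "nat \<Rightarrow> (nat \<Rightarrow> real) \<Rightarrow> real"
  where "prism_height j y = 1 - (\<Sum>i\<le>j. y i)"

lemma degeneracy_in:
  assumes "y \<in> standard_simplex (Suc k)" and "j \<le> k"
  shows "degeneracy j y \<in> standard_simplex k"
proof (rule standard_simplexI)
  note y = standard_simplexD[OF assms(1)]
  show "0 \<le> degeneracy j y i" for i using y(1) by (simp add: degeneracy_def)
  show "degeneracy j y i = 0" if "i > k" for i using y(3) that assms(2) by (simp add: degeneracy_def)
  have "(\<Sum>i\<le>k. degeneracy j y i) = degeneracy j y j + (\<Sum>i\<in>{..k} - {j}. degeneracy j y i)"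
    by (rule sum.remove) (use assms in auto)
  also have "(\<Sum>i\<in>{..k} - {j}. degeneracy j y i) = (\<Sum>i\<in>{..Suc k} - {j} - {Suc j}. y i)"
    by (rule sum.reindex_bij_witness[where j = "\<lambda>i. if i < j then i else Suc i"
          and i = "\<lambda>i. if i < j then i else i - 1"])
      (use assms in \<open>auto simp: degeneracy_def\<close>)
  also have "degeneracy j y j + \<dots> = (\<Sum>i\<le>Suc k. y i)"
    using assms(2) sum.remove[of "{..Suc k}" j y] sum.remove[of "{..Suc k} - {j}" "Suc j" y]
    by (simp add: degeneracy_def del: sum.atMost_Suc)
  finally show "(\<Sum>i\<le>k. degeneracy j y i) = 1" using y(4) by simp
qed

lemma prism_height_bounds:
  assumes "y \<in> standard_simplex k"
  shows "prism_height j y \<in> {0..1}"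
proof -
  note y = standard_simplexD[OF assms]
  have "(\<Sum>i\<le>j. y i) \<le> (\<Sum>i\<le>max j k. y i)" using y(1) by (intro sum_mono2) auto
  also have "\<dots> = (\<Sum>i\<le>k. y i)" using y(3) by (intro sum.mono_neutral_right) auto
  finally show ?thesis using y by (simp add: prism_height_def sum_nonneg)
qed

lemma prism_height_top: "y \<in> standard_simplex k \<Longrightarrow> prism_height k y = 0"
  using standard_simplexD(4) by (simp add: prism_height_def)

text \<open>This and the next two facts are the cosimplicial identities between codegeneracies and
  cofaces. The cancelling cofaces \<open>j\<close> and \<open>Suc j\<close> are those along which
  neighbouring simplices of the prism are glued.\<close>

lemma degeneracy_face_below: "l < j \<Longrightarrow> degeneracy j (simplical_face l y) = simplical_face l (degeneracy (j - 1) y)"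
  by (auto simp: degeneracy_def simplical_face_def fun_eq_iff)

lemma degeneracy_face_cancel: "l = j \<or> l = Suc j \<Longrightarrow> degeneracy j (simplical_face l y) = y"
  by (auto simp: degeneracy_def simplical_face_def fun_eq_iff)

lemma degeneracy_face_above: "Suc j < l \<Longrightarrow> degeneracy j (simplical_face l y) = simplical_face (l - 1) (degeneracy j y)"
  by (auto simp: degeneracy_def simplical_face_def fun_eq_iff)

lemma prism_height_face_below:
  assumes "l \<le> j" "0 < j"
  shows "prism_height j (simplical_face l y) = prism_height (j - 1) y"
  using sum_simplical_face[of l "j - 1" "\<lambda>a. a" y] assms by (simp add: prism_height_def)

lemma prism_height_face_0: "prism_height 0 (simplical_face 0 y) = 1"
  by (simp add: prism_height_def simplical_face_def)

lemma prism_height_face_above: "j < l \<Longrightarrow> prism_height j (simplical_face l y) = prism_height j y"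
  by (simp add: prism_height_def simplical_face_def)

lemma degeneracy_vertex:
  "degeneracy j (unit_vertex l) = unit_vertex (if l \<le> j then l else l - 1)"
  by (auto simp: degeneracy_def fun_eq_iff)

lemma prism_height_vertex: "prism_height j (unit_vertex l) = (if l \<le> j then 0 else 1)"
  by (simp add: prism_height_def)

lemma continuous_map_degeneracy:
  assumes "j \<le> k"
  shows "continuous_map (simplex_top (Suc k)) (simplex_top k) (degeneracy j)"
proof -
  have "continuous_map (simplex_top (Suc k)) euclideanreal (\<lambda>y. degeneracy j y i)" for i
    unfolding degeneracy_def
    by (auto intro!: continuous_intros continuous_map_from_subtopology continuous_map_product_projection)
  then show ?thesis
    using degeneracy_in[OF _ assms]
    by (auto simp: continuous_map_in_subtopology continuous_map_componentwise_UNIV)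
qed

lemma continuous_map_prism_height:
  "continuous_map (simplex_top k) euclideanreal (prism_height j)"
  unfolding prism_height_def
  by (intro continuous_intros continuous_map_from_subtopology continuous_map_product_projection) auto

lemma continuous_map_simplical_face:
  assumes "l \<le> Suc k"
  shows "continuous_map (simplex_top k) (simplex_top (Suc k)) (simplical_face l)"
proof -
  have "continuous_map (simplex_top k) euclideanreal (\<lambda>y. simplical_face l y i)" for i
    unfolding simplical_face_def
    by (auto intro!: continuous_map_from_subtopology continuous_map_product_projection)
  then show ?thesis
    using assms by (auto simp: continuous_map_in_subtopology continuous_map_componentwise_UNIV
        intro!: simplical_face_in_standard_simplex)
qed

lemma simplical_face_vertex:
  "simplical_face l (unit_vertex j) = unit_vertex (if j < l then j else Suc j)"
  by (auto simp: simplical_face_def fun_eq_iff)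

subsection \<open>Borel maps between spaces of simplices\<close>

lemma borel_of_open: "openin T U \<Longrightarrow> U \<in> sets (borel_of T)"
  by (simp add: sets_borel_of)

lemma continuous_imp_borel_measurable:
  assumes "continuous_map S T f"
  shows "f \<in> borel_of S \<rightarrow>\<^sub>M borel_of T"
proof (rule measurable_sigma_sets[OF sets_borel_of])
  show "{U. openin T U} \<subseteq> Pow (topspace T)" by (auto dest: openin_subset)
  show "f \<in> space (borel_of S) \<rightarrow> topspace T" using assms by (auto simp: continuous_map_def)
  show "f -` U \<inter> space (borel_of S) \<in> sets (borel_of S)" if "U \<in> {U. openin T U}" for U
    using assms that by (auto simp: continuous_map_alt intro: borel_of_open)
qed

text \<open>Generating a sigma-algebra commutes with taking traces, for an arbitrary
  \<open>A\<close>. This generality matters: points of \<open>X\<close> need not be closed, so the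
  based simplices need not form a Borel set.\<close>

lemma sets_borel_of_subtopology:
  "sets (borel_of (subtopology T A)) = sets (restrict_space (borel_of T) A)"
proof -
  let ?\<Omega> = "topspace T \<inter> A"
  have "sets (borel_of (subtopology T A)) = sigma_sets ?\<Omega> {id -` U \<inter> ?\<Omega> |U. U \<in> {U. openin T U}}"
  proof -
    have "{V. openin (subtopology T A) V} = (\<lambda>U. U \<inter> A) ` {U. openin T U}"
      by (auto simp: openin_subtopology)
    also have "\<dots> = (\<lambda>U. id -` U \<inter> ?\<Omega>) ` {U. openin T U}"
      by (rule image_cong) (auto dest: openin_subset)
    finally have "{V. openin (subtopology T A) V} = {id -` U \<inter> ?\<Omega> |U. U \<in> {U. openin T U}}"
      by (simp only: Setcompr_eq_image)
    then show ?thesis by (simp add: sets_borel_of)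
  qed
  also have "\<dots> = {id -` U \<inter> ?\<Omega> |U. U \<in> sigma_sets (topspace T) {U. openin T U}}"
    by (rule sigma_sets_vimage_commute[symmetric]) auto
  also have "\<dots> = (\<inter>) A ` sets (borel_of T)"
  proof -
    have "(\<lambda>U. id -` U \<inter> ?\<Omega>) ` sets (borel_of T) = (\<inter>) A ` sets (borel_of T)"
      by (rule image_cong) (auto dest!: sets.sets_into_space)
    then show ?thesis by (simp only: Setcompr_eq_image sets_borel_of)
  qed
  finally show ?thesis by (simp add: sets_restrict_space)
qed

lemma measurable_subtopologies:
  assumes "f \<in> borel_of S \<rightarrow>\<^sub>M borel_of T" and "f \<in> topspace S \<inter> A \<rightarrow> B"
  shows "f \<in> borel_of (subtopology S A) \<rightarrow>\<^sub>M borel_of (subtopology T B)"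
proof -
  have "f \<in> restrict_space (borel_of S) A \<rightarrow>\<^sub>M restrict_space (borel_of T) B"
    using assms by (intro measurable_restrict_space2 measurable_restrict_space1)
      (auto simp: space_restrict_space)
  then show ?thesis
    by (simp cong: measurable_cong_sets add: sets_borel_of_subtopology)
qed

text \<open>To be used with \<open>Y\<close> a piece, \<open>f\<close> the track map and
  \<open>C\<close> the set of times taken on a compact part of a corner.\<close>

lemma openin_tube:
  assumes f: "continuous_map (prod_topology Y Z) X f" and C: "compactin Z C" and U: "openin X U"
  shows "openin Y {v \<in> topspace Y. \<forall>s\<in>C. f (v, s) \<in> U}"
proof (subst openin_subopen, intro ballI)
  fix v assume v: "v \<in> {v \<in> topspace Y. \<forall>s\<in>C. f (v, s) \<in> U}"
  let ?W = "{p \<in> topspace (prod_topology Y Z). f p \<in> U}"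
  have "openin (prod_topology Y Z) ?W"
    using f U by (rule openin_continuous_map_preimage)
  moreover have "{v} \<times> C \<subseteq> ?W"
    using v compactin_subset_topspace[OF C] by auto
  ultimately obtain V V' where V: "openin Y V" "v \<in> V" "C \<subseteq> V'" "V \<times> V' \<subseteq> ?W"
    using tube_lemma_right[of Y Z ?W C v] C v by auto
  then show "\<exists>V. openin Y V \<and> v \<in> V \<and> V \<subseteq> {v \<in> topspace Y. \<forall>s\<in>C. f (v, s) \<in> U}"
    by (intro exI[of _ V]) (use openin_subset in fastforce)
qed

lemma openin_simplices:
  assumes "compactin (simplex_top k) K" and "openin X U"
  shows "openin (simplices X k) {\<sigma> \<in> topspace (simplices X k). \<sigma> ` K \<subseteq> U}"
proof -
  have "{\<sigma> \<in> topspace (simplices X k). \<sigma> ` K \<subseteq> U}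
    = {f \<in> Collect (singular_simplex k X). f ` K \<subseteq> U}" by simp
  also have "\<dots> = {f \<in> extensional (topspace (simplex_top k)). continuous_map (simplex_top k) X f \<and> f ` K \<subseteq> U}"
    by (auto simp: singular_simplex_def topspace_standard_simplex)
  finally show ?thesis
    unfolding simplices_def compact_open_topology_def
    using assms by (auto intro!: topology_generated_by_Basis)
qed

lemma continuous_map_into_simplices:
  assumes "\<And>y. y \<in> topspace Y \<Longrightarrow> singular_simplex k X (f y)"
    and "\<And>K U. \<lbrakk>compactin (simplex_top k) K; openin X U\<rbrakk> \<Longrightarrow> openin Y {y \<in> topspace Y. f y ` K \<subseteq> U}"
  shows "continuous_map Y (simplices X k) f"
  unfolding simplices_def compact_open_topology_def
proof (rule continuous_on_generated_topo)
  let ?S = "{{f \<in> extensional (topspace (simplex_top k)). continuous_map (simplex_top k) X f \<and> f ` K \<subseteq> U} |K U.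
         compactin (simplex_top k) K \<and> openin X U}"
  have "topspace (simplices X k) = \<Union>?S"
    unfolding simplices_def compact_open_topology_def topology_generated_by_topspace by simp
  moreover have "f ` topspace Y \<subseteq> topspace (simplices X k)" using assms(1) by auto
  ultimately show "f ` topspace Y \<subseteq> \<Union>?S" by (simp only:)
  fix V assume "V \<in> ?S"
  then obtain K U where KU: "compactin (simplex_top k) K" "openin X U"
    and V: "V = {f \<in> extensional (topspace (simplex_top k)). continuous_map (simplex_top k) X f \<and> f ` K \<subseteq> U}"
    by auto
  have "f -` V \<inter> topspace Y = {y \<in> topspace Y. f y ` K \<subseteq> U}"
    using assms(1) by (auto simp: V singular_simplex_def topspace_standard_simplex)
  then show "openin Y (f -` V \<inter> topspace Y)" using assms(2)[OF KU] by simp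
qed

text \<open>A single point is compact, so evaluation is tested by a subbasic open set. At the
  vertices this makes the choice of pieces a Borel condition on the simplex.\<close>

lemma continuous_map_evaluation:
  assumes "p \<in> standard_simplex k"
  shows "continuous_map (simplices X k) X (\<lambda>\<sigma>. \<sigma> p)"
proof (rule continuous_map_alt[THEN iffD2], intro conjI allI impI)
  show "(\<lambda>\<sigma>. \<sigma> p) \<in> topspace (simplices X k) \<rightarrow> topspace X"
    using assms by (auto simp: singular_simplex_def continuous_map_def)
  fix U assume "openin X U"
  with assms have "openin (simplices X k) {\<sigma> \<in> topspace (simplices X k). \<sigma> ` {p} \<subseteq> U}"
    by (intro openin_simplices) auto
  also have "{\<sigma> \<in> topspace (simplices X k). \<sigma> ` {p} \<subseteq> U} = (\<lambda>\<sigma>. \<sigma> p) -` U \<inter> topspace (simplices X k)"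
    by auto
  finally show "openin (simplices X k) ((\<lambda>\<sigma>. \<sigma> p) -` U \<inter> topspace (simplices X k))" .
qed

lemma continuous_map_singular_face:
  assumes "i \<le> Suc k"
  shows "continuous_map (simplices X (Suc k)) (simplices X k) (singular_face (Suc k) i)"
proof (rule continuous_map_into_simplices)
  show "singular_simplex k X (singular_face (Suc k) i \<sigma>)" if "\<sigma> \<in> topspace (simplices X (Suc k))" for \<sigma>
    using singular_simplex_singular_face[of "Suc k" X \<sigma> i] that assms by simp
  fix K U assume K: "compactin (simplex_top k) K" and U: "openin X U"
  have "compactin (simplex_top (Suc k)) (simplical_face i ` K)"
    using image_compactin[OF K continuous_map_simplical_face[OF assms]] .
  moreover have "singular_face (Suc k) i \<sigma> ` K = \<sigma> ` simplical_face i ` K" for \<sigma> :: "'a sing_simplex"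
    using compactin_subset_topspace[OF K] by (force simp: singular_face_def image_def topspace_standard_simplex)
  ultimately show "openin (simplices X (Suc k))
      {\<sigma> \<in> topspace (simplices X (Suc k)). singular_face (Suc k) i \<sigma> ` K \<subseteq> U}"
    using openin_simplices[OF _ U] by simp
qed

lemma simplicial_vertex_singular_face:
  assumes "j \<le> k"
  shows "simplicial_vertex j (singular_face (Suc k) i \<sigma>) = simplicial_vertex (if j < i then j else Suc j) \<sigma>"
  using assms by (simp add: simplicial_vertex_def singular_face_def simplical_face_vertex)

lemma simplex_family_simplices: "simplex_family (simplices X)"
  by unfold_locales (intro continuous_imp_borel_measurable continuous_map_singular_face)

lemma simplex_family_based_simplices: "simplex_family (based_simplices X x0)"
proof
  fix i k :: nat assume i: "i \<le> Suc k"
  show "singular_face (Suc k) i \<in> borel_of (based_simplices X x0 (Suc k)) \<rightarrow>\<^sub>M borel_of (based_simplices X x0 k)"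
    unfolding based_simplices_def
    by (rule measurable_subtopologies)
      (auto intro!: continuous_imp_borel_measurable continuous_map_singular_face i
        simp: simplicial_vertex_singular_face)
qed

subsection \<open>Dragging the vertices to the base point\<close>

locale contracting_partition =
  fixes X :: "'a topology" and x0 :: 'a and N :: nat and piece :: "'a \<Rightarrow> nat" and G :: "'a \<Rightarrow> real \<Rightarrow> 'a"
  assumes base_point: "x0 \<in> topspace X"
    and piece_le: "v \<in> topspace X \<Longrightarrow> piece v \<le> N"
    and piece_borel: "{v \<in> topspace X. piece v = i} \<in> sets (borel_of X)"
    and G_continuous: "continuous_map
      (prod_topology (subtopology X {v. piece v = i}) (top_of_set {0..1})) X (\<lambda>(v, s). G v s)"
    and G_0: "v \<in> topspace X \<Longrightarrow> G v 0 = v"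
    and G_1: "v \<in> topspace X \<Longrightarrow> G v 1 = x0"
begin

text \<open>
  \<open>G\<close> is continuous only over each piece. The formula below is still continuous in \<open>y\<close>:
  where \<open>travel\<close> is nonzero, \<open>squeeze\<close> is constantly a vertex, and elsewhere \<open>G\<close> is the identity.
\<close>

definition deform ::
    "nat \<Rightarrow> ((nat \<Rightarrow> real) \<Rightarrow> nat \<Rightarrow> real) \<Rightarrow> ((nat \<Rightarrow> real) \<Rightarrow> real) \<Rightarrow> nat
      \<Rightarrow> 'a sing_simplex \<Rightarrow> 'a sing_simplex"
  where "deform k a b m \<sigma> =
    (\<lambda>y\<in>standard_simplex m. G (\<sigma> (squeeze k (b y) (a y))) (travel k (b y) (a y)))"

lemma deform_cong:
  assumes "\<And>y. y \<in> standard_simplex m \<Longrightarrow> a y = a' y" and "\<And>y. y \<in> standard_simplex m \<Longrightarrow> b y = b' y"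
  shows "deform k a b m \<sigma> = deform k a' b' m \<sigma>"
  unfolding deform_def using assms by (intro restrict_ext) simp

lemma singular_face_deform:
  assumes "i \<le> Suc m"
  shows "singular_face (Suc m) i (deform k a b (Suc m) \<sigma>)
    = deform k (\<lambda>y. a (simplical_face i y)) (\<lambda>y. b (simplical_face i y)) m \<sigma>"
proof -
  have "simplical_face i y \<in> standard_simplex (Suc m)" if "y \<in> standard_simplex m" for y :: "nat \<Rightarrow> real"
    using assms that by (auto intro!: simplical_face_in_standard_simplex)
  then show ?thesis
    by (simp add: singular_face_def deform_def cong: restrict_cong)
qed

text \<open>If all positions \<open>a y\<close> lie on a face, squeezing keeps them there and the
  travel times do not change, so only that face of \<open>\<sigma>\<close> is read.\<close>

lemma deform_face:
  assumes "l \<le> Suc k" and "\<And>y. y \<in> standard_simplex m \<Longrightarrow> a y \<in> standard_simplex k"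
    and "\<And>y. y \<in> standard_simplex m \<Longrightarrow> b y \<in> {0..1}"
  shows "deform (Suc k) (\<lambda>y. simplical_face l (a y)) b m \<sigma> = deform k a b m (singular_face (Suc k) l \<sigma>)"
  unfolding deform_def
proof (rule restrict_ext)
  fix y :: "nat \<Rightarrow> real" assume y: "y \<in> standard_simplex m"
  have "squeeze k (b y) (a y) \<in> standard_simplex k"
    by (rule squeeze_in) (use assms y in auto)
  then show "G (\<sigma> (squeeze (Suc k) (b y) (simplical_face l (a y)))) (travel (Suc k) (b y) (simplical_face l (a y)))
    = G (singular_face (Suc k) l \<sigma> (squeeze k (b y) (a y))) (travel k (b y) (a y))"
    using assms(2,3)[OF y] assms(1) by (simp add: squeeze_face travel_face singular_face_def)
qed

lemma deform_height_0:
  assumes \<sigma>: "singular_simplex k X \<sigma>"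
  shows "deform k (\<lambda>y. y) (\<lambda>_. 0) k \<sigma> = \<sigma>"
proof -
  have "\<sigma> y \<in> topspace X" if "y \<in> standard_simplex k" for y
    using \<sigma> that by (auto simp: singular_simplex_def continuous_map_def)
  then have "deform k (\<lambda>y. y) (\<lambda>_. 0) k \<sigma> = restrict \<sigma> (standard_simplex k)"
    unfolding deform_def by (intro restrict_ext) (simp add: squeeze_0 travel_0 G_0)
  then show ?thesis
    using \<sigma> by (simp add: singular_simplex_def extensional_restrict)
qed

lemma simplicial_vertex_in:
  assumes "singular_simplex k X \<sigma>" and "l \<le> k"
  shows "\<sigma> (unit_vertex l) \<in> topspace X"
  using assms by (auto simp: singular_simplex_def continuous_map_def)

lemma simplicial_vertex_deform:
  assumes "singular_simplex k X \<sigma>" and "l \<le> m" and "a (unit_vertex l) = unit_vertex l'" and "l' \<le> k"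
    and "b (unit_vertex l) \<in> {0, 1}"
  shows "simplicial_vertex l (deform k a b m \<sigma>) = (if b (unit_vertex l) = 0 then \<sigma> (unit_vertex l') else x0)"
proof -
  have "squeeze k (b (unit_vertex l)) (unit_vertex l') = unit_vertex l'"
    "travel k (b (unit_vertex l)) (unit_vertex l') = b (unit_vertex l)"
    using assms by (auto intro!: squeeze_vertex travel_vertex)
  then show ?thesis
    using assms(2,3,5) simplicial_vertex_in[OF assms(1,4)]
    by (auto simp: simplicial_vertex_def deform_def G_0 G_1)
qed

lemma continuous_map_G_path:
  assumes "v \<in> topspace X" and "continuous_map Y (top_of_set {0..1}) c"
  shows "continuous_map Y X (\<lambda>y. G v (c y))"
proof -
  have "continuous_map Y (prod_topology (subtopology X {w. piece w = piece v}) (top_of_set {0..1})) (\<lambda>y. (v, c y))"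
    using assms by (simp add: continuous_map_pairedI continuous_map_in_subtopology)
  from continuous_map_compose[OF this G_continuous] show ?thesis by (simp add: o_def)
qed

section \<open>Continuity and Borel measurability of the deformation\<close>

context
  fixes k m :: nat and a :: "(nat \<Rightarrow> real) \<Rightarrow> nat \<Rightarrow> real" and b :: "(nat \<Rightarrow> real) \<Rightarrow> real"
  assumes a: "continuous_map (simplex_top m) (simplex_top k) a"
    and b: "continuous_map (simplex_top m) euclideanreal b"
    and b01: "\<And>y. y \<in> standard_simplex m \<Longrightarrow> b y \<in> {0..1}"
begin

text \<open>The functions \<open>a\<close> and \<open>b\<close> give a position in the simplex and a
  time for each parameter \<open>y\<close>. The inequalities here and in \<open>off_vertices\<close>
  are not strict, so all these sets are closed and meet along the rims of the corners, where both
  descriptions of \<open>deform\<close> are valid.\<close>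

definition near_vertex :: "nat \<Rightarrow> (nat \<Rightarrow> real) set"
  where "near_vertex j = {y \<in> standard_simplex m. 1 - a y j \<le> b y / 6}"

definition off_vertices :: "(nat \<Rightarrow> real) set"
  where "off_vertices = {y \<in> standard_simplex m. \<forall>j\<le>k. b y / 6 \<le> 1 - a y j}"

lemma a_in: "y \<in> standard_simplex m \<Longrightarrow> a y \<in> standard_simplex k"
  using a by (auto simp: continuous_map_in_subtopology)

lemma a_continuous: "continuous_map (simplex_top m) (powertop_real UNIV) a"
  using a by (simp add: continuous_map_in_subtopology)

lemma gap_continuous: "continuous_map (simplex_top m) euclideanreal (\<lambda>y. b y / 6 - (1 - a y j))"
  by (intro continuous_intros continuous_map_component[OF a_continuous] b) auto

lemma closedin_near_vertex: "closedin (simplex_top m) (near_vertex j)"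
proof -
  have "near_vertex j = {y \<in> topspace (simplex_top m). b y / 6 - (1 - a y j) \<in> {0..}}"
    by (auto simp: near_vertex_def)
  then show ?thesis
    using closedin_continuous_map_preimage[OF gap_continuous, of "{0..}"] by simp
qed

lemma closedin_off_vertices: "closedin (simplex_top m) off_vertices"
proof -
  have "off_vertices = standard_simplex m \<inter>
      (\<Inter>j\<in>{..k}. {y \<in> topspace (simplex_top m). b y / 6 - (1 - a y j) \<in> {..0}})"
    by (auto simp: off_vertices_def)
  moreover have "closedin (simplex_top m) {y \<in> topspace (simplex_top m). b y / 6 - (1 - a y j) \<in> {..0}}" for j
    by (rule closedin_continuous_map_preimage[OF gap_continuous]) simp
  moreover have "closedin (simplex_top m) (standard_simplex m)"
    using closedin_topspace[of "simplex_top m"] by (simp add: topspace_standard_simplex)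
  ultimately show ?thesis
    by (simp only:) (intro closedin_Int closedin_INT; simp)
qed

lemma cover: "y \<in> standard_simplex m \<Longrightarrow> y \<in> off_vertices \<or> (\<exists>j\<le>k. y \<in> near_vertex j)"
  by (force simp: off_vertices_def near_vertex_def)

lemma squeeze_map: "continuous_map (simplex_top m) (simplex_top k) (\<lambda>y. squeeze k (b y) (a y))"
  by (rule continuous_map_squeeze[OF a b]) (use b01 in simp)

lemma travel_map: "continuous_map (simplex_top m) (top_of_set {0..1}) (\<lambda>y. travel k (b y) (a y))"
  using continuous_map_travel[OF a_continuous b] travel_bounds a_in b01
  by (auto simp: continuous_map_in_subtopology)

lemma value_near_vertex:
  assumes "y \<in> near_vertex j" and "j \<le> k"
  shows "deform k a b m \<sigma> y = G (\<sigma> (unit_vertex j)) (travel k (b y) (a y))"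
  using assms a_in[of y] b01[of y] squeeze_near_vertex[of "a y" k "b y" j]
  by (simp add: near_vertex_def deform_def)

lemma squeeze_map_in: "y \<in> standard_simplex m \<Longrightarrow> squeeze k (b y) (a y) \<in> standard_simplex k"
  using squeeze_map by (auto simp: continuous_map_in_subtopology)

lemma value_off_vertices:
  assumes "singular_simplex k X \<sigma>" and y: "y \<in> off_vertices"
  shows "deform k a b m \<sigma> y = \<sigma> (squeeze k (b y) (a y))"
proof -
  have ym: "y \<in> standard_simplex m" using y by (simp add: off_vertices_def)
  then have "\<sigma> (squeeze k (b y) (a y)) \<in> topspace X"
    using squeeze_map_in[OF ym] assms(1) by (auto simp: singular_simplex_def continuous_map_def)
  moreover have "travel k (b y) (a y) = 0"
    by (rule travel_away_from_vertices) (use y ym a_in b01[OF ym] in \<open>auto simp: off_vertices_def\<close>)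
  ultimately show ?thesis using ym by (simp add: deform_def G_0)
qed

text \<open>Over a corner the map follows the track of one vertex; over the rest it is
  \<open>\<sigma>\<close> composed with the squeezing. Both are continuous on closed sets, finitely
  many of which cover the simplex.\<close>

lemma singular_simplex_deform:
  assumes \<sigma>: "singular_simplex k X \<sigma>"
  shows "singular_simplex m X (deform k a b m \<sigma>)"
proof -
  let ?f = "deform k a b m \<sigma>"
  \<comment> \<open>Indices up to \<open>k\<close> denote the corners, and \<open>Suc k\<close> the
    remaining region.\<close>
  define C where "C j = (if j \<le> k then near_vertex j else off_vertices)" for j
  have "continuous_map (subtopology (simplex_top m) (C j)) X ?f" if "j \<in> {..Suc k}" for j
  proof (cases "j \<le> k")
    case True
    have "continuous_map (subtopology (simplex_top m) (C j)) X
        (\<lambda>y. G (\<sigma> (unit_vertex j)) (travel k (b y) (a y)))"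
      by (intro continuous_map_G_path continuous_map_from_subtopology travel_map
          simplicial_vertex_in[OF \<sigma> True])
    then show ?thesis
      by (rule continuous_map_eq) (use True in \<open>auto simp: C_def intro: value_near_vertex[symmetric]\<close>)
  next
    case False
    have "continuous_map (simplex_top m) X (\<sigma> \<circ> (\<lambda>y. squeeze k (b y) (a y)))"
      using squeeze_map \<sigma> by (auto simp: singular_simplex_def intro: continuous_map_compose)
    then have "continuous_map (subtopology (simplex_top m) (C j)) X (\<sigma> \<circ> (\<lambda>y. squeeze k (b y) (a y)))"
      by (rule continuous_map_from_subtopology)
    then show ?thesis
      by (rule continuous_map_eq) (use False in \<open>simp add: C_def value_off_vertices[OF \<sigma>]\<close>)
  qed
  then have "continuous_map (simplex_top m) X ?f"
  proof (rule pasting_lemma_closed[where I = "{..Suc k}" and T = C and f = "\<lambda>_. ?f", OF finite_atMost, rotated])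
    show "closedin (simplex_top m) (C j)" for j
      by (simp add: C_def closedin_near_vertex closedin_off_vertices)
    show "\<exists>j. j \<in> {..Suc k} \<and> y \<in> C j \<and> ?f y = ?f y" if "y \<in> topspace (simplex_top m)" for y
      using cover[of y] that by (force simp: C_def)
  qed simp_all
  then show ?thesis
    by (simp add: singular_simplex_def deform_def)
qed

text \<open>Once \<open>\<iota>\<close> fixes the pieces of the vertices, sending \<open>K\<close>
  into \<open>U\<close> splits into finitely many open conditions: \<open>\<sigma>\<close> maps a
  compact set into \<open>U\<close>, and for each vertex the track stays in \<open>U\<close> during
  a compact set of times.\<close>

lemma continuous_map_deform:
  "continuous_map (subtopology (simplices X k) {\<sigma>. \<forall>j\<le>k. piece (\<sigma> (unit_vertex j)) = \<iota> j}) (simplices X m)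
    (deform k a b m)"
    (is "continuous_map (subtopology _ ?A) _ _")
proof (rule continuous_map_into_simplices)
  let ?S = "subtopology (simplices X k) ?A"
  show "singular_simplex m X (deform k a b m \<sigma>)" if "\<sigma> \<in> topspace ?S" for \<sigma>
    using that by (intro singular_simplex_deform) simp
  fix K U assume K: "compactin (simplex_top m) K" and U: "openin X U"
  have Km: "K \<subseteq> standard_simplex m"
    using compactin_subset_topspace[OF K] by simp
  \<comment> \<open>The points at which \<open>\<sigma>\<close> itself is evaluated when
    \<open>y\<close> ranges over the part of \<open>K\<close> away from the corners.\<close>
  let ?L = "(\<lambda>y. squeeze k (b y) (a y)) ` (off_vertices \<inter> K)"
  let ?t = "\<lambda>y. travel k (b y) (a y)"
  have off: "openin ?S ({\<sigma> \<in> topspace (simplices X k). \<sigma> ` ?L \<subseteq> U} \<inter> ?A)"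
  proof (intro openin_subtopology_Int openin_simplices U)
    show "compactin (simplex_top k) ?L"
      by (rule image_compactin[OF closed_Int_compactin[OF closedin_off_vertices K] squeeze_map])
  qed
  have near: "openin ?S {\<sigma> \<in> topspace ?S. \<forall>s\<in>?t ` (near_vertex j \<inter> K). G (\<sigma> (unit_vertex j)) s \<in> U}"
    if j: "j \<le> k" for j
  proof -
    let ?Y = "subtopology X {v. piece v = \<iota> j}"
    have "compactin (top_of_set {0..1}) (?t ` (near_vertex j \<inter> K))"
      by (rule image_compactin[OF closed_Int_compactin[OF closedin_near_vertex K] travel_map])
    from openin_tube[OF G_continuous this U]
    have "openin ?Y {v \<in> topspace ?Y. \<forall>s\<in>?t ` (near_vertex j \<inter> K). G v s \<in> U}" (is "openin ?Y ?W")
      by simp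
    moreover have "continuous_map ?S ?Y (\<lambda>\<sigma>. \<sigma> (unit_vertex j))"
      using j continuous_map_evaluation[of "unit_vertex j" k X]
      by (auto simp: continuous_map_in_subtopology intro: continuous_map_from_subtopology)
    ultimately have "openin ?S {\<sigma> \<in> topspace ?S. \<sigma> (unit_vertex j) \<in> ?W}"
      by (intro openin_continuous_map_preimage)
    also have "{\<sigma> \<in> topspace ?S. \<sigma> (unit_vertex j) \<in> ?W}
      = {\<sigma> \<in> topspace ?S. \<forall>s\<in>?t ` (near_vertex j \<inter> K). G (\<sigma> (unit_vertex j)) s \<in> U}"
      using j simplicial_vertex_in by auto
    finally show ?thesis .
  qed
  have "openin ?S (({\<sigma> \<in> topspace (simplices X k). \<sigma> ` ?L \<subseteq> U} \<inter> ?A) \<inter>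
      (\<Inter>j\<in>{..k}. {\<sigma> \<in> topspace ?S. \<forall>s\<in>?t ` (near_vertex j \<inter> K). G (\<sigma> (unit_vertex j)) s \<in> U}))"
    by (rule openin_Int[OF off openin_Inter]) (use near in \<open>blast+\<close>)
  also have "\<dots> = {\<sigma> \<in> topspace ?S. deform k a b m \<sigma> ` K \<subseteq> U}" (is "?l = ?r")
  proof
    show "?l \<subseteq> ?r"
    proof
      fix \<sigma> assume \<sigma>: "\<sigma> \<in> ?l"
      then have sing: "singular_simplex k X \<sigma>" by simp
      have "deform k a b m \<sigma> y \<in> U" if y: "y \<in> K" for y
      proof -
        consider "y \<in> off_vertices" | j where "j \<le> k" "y \<in> near_vertex j"
          using cover y Km by blast
        then show ?thesis
        proof cases
          case 1
          then have "\<sigma> (squeeze k (b y) (a y)) \<in> U" using \<sigma> y by blast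
          then show ?thesis using value_off_vertices[OF sing 1] by simp
        next
          case 2
          then have "G (\<sigma> (unit_vertex j)) (?t y) \<in> U" using \<sigma> y by blast
          then show ?thesis using value_near_vertex[OF 2(2,1)] by simp
        qed
      qed
      then show "\<sigma> \<in> ?r" using \<sigma> by auto
    qed
    show "?r \<subseteq> ?l"
    proof
      fix \<sigma> assume \<sigma>: "\<sigma> \<in> ?r"
      then have sing: "singular_simplex k X \<sigma>" by simp
      have "\<sigma> ` ?L \<subseteq> U"
        using \<sigma> value_off_vertices[OF sing] by (auto simp: image_subset_iff)
      moreover have "G (\<sigma> (unit_vertex j)) (?t y) \<in> U" if "j \<le> k" "y \<in> near_vertex j \<inter> K" for j y
        using \<sigma> value_near_vertex[of y j \<sigma>] that by (auto simp: image_subset_iff)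
      ultimately show "\<sigma> \<in> ?l" using \<sigma> by auto
    qed
  qed
  finally show "openin ?S {\<sigma> \<in> topspace ?S. deform k a b m \<sigma> ` K \<subseteq> U}" .
qed

text \<open>The patterns \<open>\<iota>\<close> cut the space of simplices into finitely many Borel
  parts, and the map is continuous on each of them.\<close>

lemma measurable_deform: "deform k a b m \<in> borel_of (simplices X k) \<rightarrow>\<^sub>M borel_of (simplices X m)"
proof -
  define A where "A \<iota> = {\<sigma>. \<forall>j\<le>k. piece (\<sigma> (unit_vertex j)) = \<iota> j}" for \<iota> :: "nat \<Rightarrow> nat"
  show ?thesis
  proof (rule measurable_piecewise_restrict)
    show "countable (A ` ({..k} \<rightarrow>\<^sub>E {..N}))"
      by (intro countable_finite finite_imageI finite_PiE) auto
    show "space (borel_of (simplices X k)) \<subseteq> \<Union> (A ` ({..k} \<rightarrow>\<^sub>E {..N}))"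
    proof
      fix \<sigma> assume "\<sigma> \<in> space (borel_of (simplices X k))"
      \<comment> \<open>Restricting the pattern to the indices up to \<open>k\<close> places it in a
        finite set of extensional functions.\<close>
      then have "(\<lambda>j\<in>{..k}. piece (\<sigma> (unit_vertex j))) \<in> {..k} \<rightarrow>\<^sub>E {..N}"
        using simplicial_vertex_in piece_le by auto
      moreover have "\<sigma> \<in> A (\<lambda>j\<in>{..k}. piece (\<sigma> (unit_vertex j)))"
        by (simp add: A_def)
      ultimately show "\<sigma> \<in> \<Union> (A ` ({..k} \<rightarrow>\<^sub>E {..N}))" by blast
    qed
  next
    fix \<Omega> assume "\<Omega> \<in> A ` ({..k} \<rightarrow>\<^sub>E {..N})"
    then obtain \<iota> where \<Omega>: "\<Omega> = A \<iota>" by blast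
    have "(\<lambda>\<sigma>. \<sigma> (unit_vertex j)) -` {v \<in> topspace X. piece v = \<iota> j} \<inter> space (borel_of (simplices X k))
        \<in> sets (borel_of (simplices X k))" if "j \<le> k" for j
      using that by (intro measurable_sets[OF continuous_imp_borel_measurable[OF continuous_map_evaluation] piece_borel]) simp
    then have "(\<Inter>j\<in>{..k}. (\<lambda>\<sigma>. \<sigma> (unit_vertex j)) -` {v \<in> topspace X. piece v = \<iota> j}
        \<inter> space (borel_of (simplices X k))) \<in> sets (borel_of (simplices X k))"
      by (intro sets.finite_INT) auto
    also have "(\<Inter>j\<in>{..k}. (\<lambda>\<sigma>. \<sigma> (unit_vertex j)) -` {v \<in> topspace X. piece v = \<iota> j}
        \<inter> space (borel_of (simplices X k))) = \<Omega> \<inter> space (borel_of (simplices X k))"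
      using simplicial_vertex_in by (auto simp: \<Omega> A_def)
    finally show "\<Omega> \<inter> space (borel_of (simplices X k)) \<in> sets (borel_of (simplices X k))" .
    have "deform k a b m \<in> borel_of (subtopology (simplices X k) \<Omega>) \<rightarrow>\<^sub>M borel_of (simplices X m)"
      unfolding \<Omega> A_def by (intro continuous_imp_borel_measurable continuous_map_deform)
    then show "deform k a b m \<in> restrict_space (borel_of (simplices X k)) \<Omega> \<rightarrow>\<^sub>M borel_of (simplices X m)"
      by (simp cong: measurable_cong_sets add: sets_borel_of_subtopology)
  qed
qed

end

section \<open>Straightening and the prism over a simplex\<close>

definition straighten :: "nat \<Rightarrow> 'a sing_simplex \<Rightarrow> 'a sing_simplex"
  where "straighten k = deform k (\<lambda>y. y) (\<lambda>_. 1) k"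

definition prism_simplex :: "nat \<Rightarrow> nat \<Rightarrow> 'a sing_simplex \<Rightarrow> 'a sing_simplex"
  where "prism_simplex k j = deform k (degeneracy j) (prism_height j) (Suc k)"

lemma measurable_straighten:
  "straighten k \<in> borel_of (simplices X k) \<rightarrow>\<^sub>M borel_of (based_simplices X x0 k)"
proof -
  have "straighten k \<in> borel_of (simplices X k) \<rightarrow>\<^sub>M borel_of (simplices X k)"
    unfolding straighten_def by (rule measurable_deform) auto
  moreover have "simplicial_vertex i (straighten k \<sigma>) = x0" if "singular_simplex k X \<sigma>" "i \<le> k" for \<sigma> i
    unfolding straighten_def using that by (subst simplicial_vertex_deform[where l' = i]) auto
  ultimately show ?thesis
    unfolding based_simplices_def
    using measurable_subtopologies[of "straighten k" "simplices X k" "simplices X k" UNIV]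
    by auto
qed

lemma measurable_prism_simplex:
  assumes "j \<le> k"
  shows "prism_simplex k j \<in> borel_of (simplices X k) \<rightarrow>\<^sub>M borel_of (simplices X (Suc k))"
  unfolding prism_simplex_def
  by (rule measurable_deform)
    (auto intro!: continuous_map_degeneracy continuous_map_prism_height assms dest: prism_height_bounds[of _ _ j])

text \<open>A vertex at height 0 is a vertex of \<open>\<sigma>\<close>, already at
  \<open>x0\<close>; a vertex at height 1 is the end of a track.\<close>

lemma measurable_based_prism_simplex:
  assumes "j \<le> k"
  shows "prism_simplex k j \<in> borel_of (based_simplices X x0 k) \<rightarrow>\<^sub>M borel_of (based_simplices X x0 (Suc k))"
  unfolding based_simplices_def
proof (rule measurable_subtopologies[OF measurable_prism_simplex[OF assms]])
  have "simplicial_vertex i (prism_simplex k j \<sigma>) = x0"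
    if \<sigma>: "singular_simplex k X \<sigma>" "\<forall>i\<le>k. simplicial_vertex i \<sigma> = x0" and "i \<le> Suc k" for \<sigma> i
  proof -
    let ?l = "if i \<le> j then i else i - 1"
    have "?l \<le> k" using assms that by auto
    then show ?thesis
      unfolding prism_simplex_def using that
      by (subst simplicial_vertex_deform[where l' = ?l])
        (auto simp: degeneracy_vertex prism_height_vertex simplicial_vertex_def)
  qed
  then show "prism_simplex k j \<in> topspace (simplices X k) \<inter> {\<sigma>. \<forall>i\<le>k. simplicial_vertex i \<sigma> = x0}
      \<rightarrow> {\<sigma>. \<forall>i\<le>Suc k. simplicial_vertex i \<sigma> = x0}"
    by auto
qed

lemma straighten_face:
  assumes "i \<le> Suc k"
  shows "singular_face (Suc k) i (straighten (Suc k) \<sigma>) = straighten k (singular_face (Suc k) i \<sigma>)"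
  unfolding straighten_def singular_face_deform[OF assms]
  by (rule deform_face) (use assms in auto)

lemma prism_simplex_first: "singular_face (Suc k) 0 (prism_simplex k 0 \<sigma>) = straighten k \<sigma>"
  unfolding prism_simplex_def straighten_def
  by (subst singular_face_deform) (auto intro!: deform_cong simp: degeneracy_face_cancel prism_height_face_0)

lemma prism_simplex_last:
  assumes "singular_simplex k X \<sigma>"
  shows "singular_face (Suc k) (Suc k) (prism_simplex k k \<sigma>) = \<sigma>"
proof -
  have "singular_face (Suc k) (Suc k) (prism_simplex k k \<sigma>) = deform k (\<lambda>y. y) (\<lambda>_. 0) k \<sigma>"
    unfolding prism_simplex_def
    by (subst singular_face_deform)
      (auto intro!: deform_cong simp: degeneracy_face_cancel prism_height_face_above prism_height_top)
  then show ?thesis using deform_height_0[OF assms] by simp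
qed

text \<open>The cosimplicial identity moves the coface outside the codegeneracy, and naturality of
  the deformation then turns it into a face of \<open>\<sigma>\<close>.\<close>

lemma prism_simplex_face_below:
  assumes "i < j" and "j \<le> k"
  shows "singular_face (Suc k) i (prism_simplex k j \<sigma>) = prism_simplex (k - 1) (j - 1) (singular_face k i \<sigma>)"
proof -
  obtain n where k: "k = Suc n" using assms by (cases k) auto
  have "singular_face (Suc k) i (prism_simplex k j \<sigma>)
    = deform (Suc n) (\<lambda>y. simplical_face i (degeneracy (j - 1) y)) (prism_height (j - 1)) k \<sigma>"
    unfolding prism_simplex_def k using assms k
    by (subst singular_face_deform) (auto simp: degeneracy_face_below prism_height_face_below)
  also have "\<dots> = deform n (degeneracy (j - 1)) (prism_height (j - 1)) k (singular_face (Suc n) i \<sigma>)"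
    by (rule deform_face) (use assms k in \<open>auto intro!: degeneracy_in dest: prism_height_bounds[of _ _ "j - 1"]\<close>)
  finally show ?thesis by (simp add: prism_simplex_def k)
qed

lemma prism_simplex_face_above:
  assumes "Suc j < i" and "i \<le> Suc k"
  shows "singular_face (Suc k) i (prism_simplex k j \<sigma>) = prism_simplex (k - 1) j (singular_face k (i - 1) \<sigma>)"
proof -
  obtain n where k: "k = Suc n" using assms by (cases k) auto
  have "singular_face (Suc k) i (prism_simplex k j \<sigma>)
    = deform (Suc n) (\<lambda>y. simplical_face (i - 1) (degeneracy j y)) (prism_height j) k \<sigma>"
    unfolding prism_simplex_def k using assms k
    by (subst singular_face_deform) (auto simp: degeneracy_face_above prism_height_face_above)
  also have "\<dots> = deform n (degeneracy j) (prism_height j) k (singular_face (Suc n) (i - 1) \<sigma>)"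
    by (rule deform_face) (use assms k in \<open>auto intro!: degeneracy_in dest: prism_height_bounds[of _ _ j]\<close>)
  finally show ?thesis by (simp add: prism_simplex_def k)
qed

text \<open>On this common face both codegeneracies cancel and both heights become
  \<open>prism_height j\<close>.\<close>

lemma prism_simplex_face_middle:
  assumes "j < k"
  shows "singular_face (Suc k) (Suc j) (prism_simplex k j \<sigma>)
    = singular_face (Suc k) (Suc j) (prism_simplex k (Suc j) \<sigma>)"
  unfolding prism_simplex_def using assms
  by (simp add: singular_face_deform degeneracy_face_cancel prism_height_face_above prism_height_face_below)

theorem restriction_induced_simplices_iso:
  assumes "cochain_class F"
  shows "restriction_induced F (simplices X) (based_simplices X x0) k
    \<in> iso (cohomology_group F (simplices X) k) (cohomology_group F (based_simplices X x0) k)"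
proof (rule cochain_class.restriction_induced_iso[OF assms, where P = straighten and h = prism_simplex])
  show "simplex_family (simplices X)" "simplex_family (based_simplices X x0)"
    by (rule simplex_family_simplices simplex_family_based_simplices)+
  show "id \<in> borel_of (based_simplices X x0 k) \<rightarrow>\<^sub>M borel_of (simplices X k)" for k
    unfolding based_simplices_def
    by (intro continuous_imp_borel_measurable continuous_map_from_subtopology continuous_map_id)
qed (simp_all add: measurable_straighten straighten_face measurable_prism_simplex
    measurable_based_prism_simplex prism_simplex_first prism_simplex_last
    prism_simplex_face_below prism_simplex_face_above prism_simplex_face_middle)

end

section \<open>From the covering to a partition with tracks\<close>

lemma contracting_partition_exists:
  assumes X: "path_connected_space X" and cover: "topspace X = (\<Union>i\<in>{1..n}. U i)"
    and borel: "\<And>i. i \<in> {1..n} \<Longrightarrow> U i \<in> sets (borel_of X)"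
    and contr: "\<And>i. i \<in> {1..n} \<Longrightarrow> contractible_subset_in X (X closure_of U i)"
    and x0: "x0 \<in> topspace X"
  shows "\<exists>piece G. contracting_partition X x0 n piece G"
proof -
  \<comment> \<open>Taking the least index makes the pieces disjoint: piece \<open>i\<close> is
    \<open>U i\<close> without the earlier sets, hence Borel.\<close>
  define piece where "piece v = (LEAST i. i \<in> {1..n} \<and> v \<in> U i)" for v
  have piece: "piece v \<in> {1..n}" "v \<in> U (piece v)" if "v \<in> topspace X" for v
  proof -
    have "\<exists>i. i \<in> {1..n} \<and> v \<in> U i" using that cover by blast
    from LeastI_ex[OF this] show "piece v \<in> {1..n}" "v \<in> U (piece v)"
      by (simp_all only: piece_def)
  qed
  have U: "U i \<subseteq> topspace X" if "i \<in> {1..n}" for i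
    using cover that by blast
  have "\<exists>h. continuous_map (prod_topology (top_of_set {0..1}) (subtopology X (U i))) X h
      \<and> (\<forall>v. h (0::real, v) = v) \<and> (\<forall>v. h (1, v) = x0)" if i: "i \<in> {1..n}" for i
  proof -
    let ?Y = "subtopology X (U i)"
    obtain c where c: "c \<in> topspace X"
      and contraction: "homotopic_with (\<lambda>_. True) (subtopology X (X closure_of U i)) X (\<lambda>x. x) (\<lambda>_. c)"
      using contr[OF i] by (auto simp: contractible_subset_in_def)
    from contraction have "homotopic_with (\<lambda>_. True) (subtopology (subtopology X (X closure_of U i)) (U i)) X (\<lambda>x. x) (\<lambda>_. c)"
      by (rule homotopic_from_subtopology)
    moreover have "X closure_of U i \<inter> U i = U i"
      using closure_of_subset[OF U[OF i]] by blast
    ultimately have "homotopic_with (\<lambda>_. True) ?Y X (\<lambda>x. x) (\<lambda>_. c)"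
      by (simp add: subtopology_subtopology)
    \<comment> \<open>The centre \<open>c\<close> depends on \<open>i\<close>; a path in
      \<open>X\<close> carries it to the common endpoint \<open>x0\<close>.\<close>
    moreover have "homotopic_with (\<lambda>_. True) ?Y X (\<lambda>_. c) (\<lambda>_. x0)"
      using X c x0 by (simp add: homotopic_constant_maps path_connected_space_iff_path_component)
    ultimately have "homotopic_with (\<lambda>_. True) ?Y X (\<lambda>x. x) (\<lambda>_. x0)"
      by (rule homotopic_with_trans)
    then show ?thesis unfolding homotopic_with_def by blast
  qed
  then obtain h where h: "\<And>i. i \<in> {1..n} \<Longrightarrow>
      continuous_map (prod_topology (top_of_set {0..1}) (subtopology X (U i))) X (h i)"
    and h0: "\<And>i v. i \<in> {1..n} \<Longrightarrow> h i (0::real, v) = v"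
    and h1: "\<And>i v. i \<in> {1..n} \<Longrightarrow> h i (1, v) = x0"
    by metis
  have "contracting_partition X x0 n piece (\<lambda>v s. h (piece v) (s, v))"
  proof
    show "piece v \<le> n" "h (piece v) (0, v) = v" "h (piece v) (1, v) = x0" if "v \<in> topspace X" for v
      using piece(1)[OF that] h0 h1 by auto
    fix i
    show "{v \<in> topspace X. piece v = i} \<in> sets (borel_of X)"
    proof (cases "i \<in> {1..n}")
      case True
      have "{v \<in> topspace X. piece v = i} = U i - (\<Union>j\<in>{1..<i}. U j)"
      proof (intro equalityI subsetI)
        fix v assume v: "v \<in> {v \<in> topspace X. piece v = i}"
        then have "v \<notin> U j" if "j \<in> {1..<i}" for j
          using not_less_Least[of j "\<lambda>i. i \<in> {1..n} \<and> v \<in> U i"] that True by (auto simp: piece_def)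
        then show "v \<in> U i - (\<Union>j\<in>{1..<i}. U j)" using v piece(2) by auto
      next
        fix v assume v: "v \<in> U i - (\<Union>j\<in>{1..<i}. U j)"
        then have "piece v = i"
          unfolding piece_def using True by (intro Least_equality) (auto simp: not_le[symmetric])
        then show "v \<in> {v \<in> topspace X. piece v = i}" using v U[OF True] by auto
      qed
      then show ?thesis using borel True by (auto intro!: sets.Diff sets.finite_UN)
    next
      case False
      then have "{v \<in> topspace X. piece v = i} = {}" using piece(1) by auto
      then show ?thesis by (simp only: sets.empty_sets)
    qed
    show "continuous_map (prod_topology (subtopology X {v. piece v = i}) (top_of_set {0..1})) X
      (\<lambda>(v, s). h (piece v) (s, v))"
    proof (cases "i \<in> {1..n}")
      case True
      let ?Y = "prod_topology (subtopology X {v. piece v = i}) (top_of_set {0..1::real})"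
      \<comment> \<open>Homotopies take the time first and tracks take the point first, so the
        factors are exchanged.\<close>
      have "continuous_map ?Y (prod_topology (top_of_set {0..1}) (subtopology X (U i))) (\<lambda>p. (snd p, fst p))"
        using piece(2) by (intro continuous_map_pairedI continuous_map_snd)
          (auto simp: continuous_map_in_subtopology intro: continuous_map_into_fulltopology[OF continuous_map_fst])
      then have "continuous_map ?Y X (h i \<circ> (\<lambda>p. (snd p, fst p)))"
        using h[OF True] by (rule continuous_map_compose)
      then show ?thesis by (rule continuous_map_eq) auto
    next
      case False
      then have "topspace (subtopology X {v. piece v = i}) = {}" using piece(1) by auto
      then show ?thesis by (auto simp: continuous_map_def)
    qed
  qed (rule x0)
  then show ?thesis by blast
qed

theorem corollary5p4:
  fixes X :: "'a topology" and U :: "nat \<Rightarrow> 'a set" and n :: nat and x0 :: 'a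
  assumes "path_connected_space X"
    and "topspace X = (\<Union>i\<in>{1..n}. U i)"
    and "\<And>i. i \<in> {1..n} \<Longrightarrow> U i \<in> sets (borel_of X)"
    and "\<And>i. i \<in> {1..n} \<Longrightarrow> compactin X (X closure_of U i)"
    and "\<And>i. i \<in> {1..n} \<Longrightarrow> contractible_subset_in X (X closure_of U i)"
    and "x0 \<in> topspace X"
  shows "\<forall>k.
    restriction_induced bounded_functions (simplices X) (based_simplices X x0) k
      \<in> iso (cohomology_group bounded_functions (simplices X) k)
            (cohomology_group bounded_functions (based_simplices X x0) k) \<and>
    restriction_induced bounded_measurable_functions (simplices X) (based_simplices X x0) k
      \<in> iso (cohomology_group bounded_measurable_functions (simplices X) k)
            (cohomology_group bounded_measurable_functions (based_simplices X x0) k) \<and>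
    restriction_induced measurable_functions (simplices X) (based_simplices X x0) k
      \<in> iso (cohomology_group measurable_functions (simplices X) k)
            (cohomology_group measurable_functions (based_simplices X x0) k)"
proof -
  obtain piece G where "contracting_partition X x0 n piece G"
    using contracting_partition_exists[OF assms(1-3,5,6)] by blast
  then interpret contracting_partition X x0 n piece G .
  show ?thesis
    using restriction_induced_simplices_iso cochain_class_bounded
      cochain_class_bounded_measurable cochain_class_measurable by blast
qed

end
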